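(* There is no generally convergent purely iterative root-finding algorithm $T: \mathrm{Poly}_{r} \dashrightarrow \mathrm{Rat}_{d}$ over a non-archimedean field of residue characteristic $p$ if $p = 0$, $p > d$, or $p \geq r$.
   Context: $\mathrm{Rat}_{d}$ is the space of rational functions of degree $d$, and $\mathrm{Poly}_{r} \subseteq \mathrm{Rat}_{r}$ is the space of degree-$r$ polynomials. A purely iterative root-finding algorithm is a rational map $T: \mathrm{Poly}_{r} \dashrightarrow \mathrm{Rat}_{d}$; the image of a polynomial $f(z)$ under $T$ is denoted $T_{f}(z)$, and $T_{f}^{n}$ denotes the $n$-th iterate of $T_{f}$. The algorithm $T$ is generally convergent if, for an open dense set of $f \in \mathrm{Poly}_{r}$, the sequence $T^{n}_{f}(z)$ converges to a root of $f$ on an open dense subset of $\mathbb{P}^{1}$. This definition is made relative to a fixed topology, here the one given by the absolute value of the non-archimedean field.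
   Formalization: The degree r is assumed to be at least 2 (for r = 1 the claim fails: T_f(z) = a + c(z − a), a the root of f, 0 < |c| < 1, is generally convergent); roots of f and points of P^1 are taken in an algebraically closed valued extension of the field, which may be the field itself. *)

theory Defs
  imports
    "HOL-Analysis.Analysis"
    "HOL-Algebra.QuotRing"
    "HOL-Algebra.Multiplicative_Group"
    "HOL-Computational_Algebra.Polynomial"
    "HOL-Library.Poly_Mapping"
begin

hide_const (open) up_ring.coeff up_ring.monom

locale nonarch_field =
  fixes v :: "'k::field \<Rightarrow> real"
  assumes nonneg: "v x \<ge> 0"
    and eq_0_iff: "v x = 0 \<longleftrightarrow> x = 0"
    and mult: "v (x * y) = v x * v y"
    and ultrametric: "v (x + y) \<le> max (v x) (v y)"
    and nontrivial: "\<exists>x. x \<noteq> 0 \<and> v x \<noteq> 1"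

text \<open>
  An algebraically closed valued extension \<open>\<iota> : K \<rightarrow> L\<close>, for instance an algebraic closure
  of \<open>K\<close> or its completion. If \<open>K\<close> is itself algebraically closed, \<open>L = K\<close> is admissible.
\<close>

locale nonarch_closure =
  K: nonarch_field v + L: nonarch_field w
  for v :: "'k::field \<Rightarrow> real" and w :: "'l::alg_closed_field \<Rightarrow> real" +
  fixes \<iota> :: "'k \<Rightarrow> 'l"
  assumes hom_1: "\<iota> 1 = 1"
    and hom_add: "\<iota> (x + y) = \<iota> x + \<iota> y"
    and hom_mult: "\<iota> (x * y) = \<iota> x * \<iota> y"
    and extends: "w (\<iota> x) = v x"

definition valuation_ring :: "('k::field \<Rightarrow> real) \<Rightarrow> 'k ring" where
  "valuation_ring v =
     \<lparr>carrier = {x. v x \<le> 1}, monoid.mult = (*), one = 1, zero = 0, add = (+)\<rparr>"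

definition residue_field :: "('k::field \<Rightarrow> real) \<Rightarrow> 'k set ring" where
  "residue_field v = valuation_ring v Quot {x. v x < 1}"

text \<open>The additive order of \<open>1\<close>; \<^const>\<open>group.ord\<close> is \<open>0\<close> for elements of infinite order.\<close>

definition residue_char :: "('k::field \<Rightarrow> real) \<Rightarrow> nat" where
  "residue_char v = group.ord (add_monoid (residue_field v)) \<one>\<^bsub>residue_field v\<^esub>"

definition field_topology :: "('k::field \<Rightarrow> real) \<Rightarrow> 'k topology" where
  "field_topology v = Metric_space.mtopology UNIV (\<lambda>x y. v (x - y))"

definition Poly :: "nat \<Rightarrow> 'k::field poly set" where
  "Poly r = {f. degree f = r}"

text \<open>
  The topology of \<open>Poly r\<close> as a subspace of the affine space of coefficient vectors; the
  coefficients of index greater than \<open>r\<close> vanish and play no role.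
\<close>

definition Poly_topology :: "('k::field \<Rightarrow> real) \<Rightarrow> nat \<Rightarrow> 'k poly topology" where
  "Poly_topology v r =
     pullback_topology (Poly r) coeff (product_topology (\<lambda>_. field_topology v) UNIV)"

datatype 'k proj_line = Fin 'k | Infty

fun proj_inv :: "'k::field proj_line \<Rightarrow> 'k proj_line" where
  "proj_inv (Fin x) = (if x = 0 then Infty else Fin (inverse x))"
| "proj_inv Infty = Fin 0"

text \<open>The two affine charts are \<open>z \<mapsto> z\<close> and \<open>z \<mapsto> 1/z\<close>.\<close>

definition proj_topology :: "('k::field \<Rightarrow> real) \<Rightarrow> 'k proj_line topology" where
  "proj_topology v = topology (\<lambda>S.
     openin (field_topology v) {x. Fin x \<in> S} \<and>
     openin (field_topology v) {x. proj_inv (Fin x) \<in> S})"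

definition dense_open :: "'a topology \<Rightarrow> 'a set \<Rightarrow> bool" where
  "dense_open X U \<longleftrightarrow> openin X U \<and> X closure_of U = topspace X"

text \<open>A pair \<open>(P, Q)\<close> represents \<open>P/Q\<close>, in lowest terms.\<close>

definition Rat_maps :: "nat \<Rightarrow> ('k::field poly \<times> 'k poly) set" where
  "Rat_maps d = {(P, Q). coprime P Q \<and> max (degree P) (degree Q) = d}"

fun rat_apply :: "'k::field poly \<times> 'k poly \<Rightarrow> 'k proj_line \<Rightarrow> 'k proj_line" where
  "rat_apply (P, Q) (Fin z) =
     (if poly Q z = 0 then Infty else Fin (poly P z / poly Q z))"
| "rat_apply (P, Q) Infty =
     (let d = max (degree P) (degree Q) in
      if coeff Q d = 0 then Infty else Fin (coeff P d / coeff Q d))"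

text \<open>Polynomials over \<open>K\<close> in variables indexed by \<^typ>\<open>nat\<close>.\<close>

type_synonym 'k mpoly = "(nat \<Rightarrow>\<^sub>0 nat) \<Rightarrow>\<^sub>0 'k"

definition mpoly_vars :: "'k::field mpoly \<Rightarrow> nat set" where
  "mpoly_vars p = (\<Union>m\<in>Poly_Mapping.keys p. Poly_Mapping.keys m)"

definition mpoly_eval :: "(nat \<Rightarrow> 'k::field) \<Rightarrow> 'k mpoly \<Rightarrow> 'k" where
  "mpoly_eval c p =
     (\<Sum>m\<in>Poly_Mapping.keys p. Poly_Mapping.lookup p m *
        (\<Prod>i\<in>Poly_Mapping.keys m. c i ^ Poly_Mapping.lookup m i))"

text \<open>
  \<open>T = (A, B)\<close> stands for
  \<open>f \<mapsto> (\<Sum>i\<le>d. A i (f) z ^ i) / (\<Sum>i\<le>d. B i (f) z ^ i)\<close>, where \<open>A i\<close> and \<open>B i\<close> are polynomials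
  in the coefficients of \<open>f\<close>. Since the coefficients of an element of \<open>Rat_maps d\<close> are
  homogeneous coordinates, denominators can be cleared and every rational map
  \<open>Poly r \<dashrightarrow> Rat d\<close> has this form.
\<close>

type_synonym 'k algorithm = "(nat \<Rightarrow> 'k mpoly) \<times> (nat \<Rightarrow> 'k mpoly)"

definition algorithm_at :: "nat \<Rightarrow> 'k::field algorithm \<Rightarrow> 'k poly \<Rightarrow> 'k poly \<times> 'k poly" where
  "algorithm_at d T f =
     (\<Sum>i\<le>d. monom (mpoly_eval (coeff f) (fst T i)) i,
      \<Sum>i\<le>d. monom (mpoly_eval (coeff f) (snd T i)) i)"

text \<open>
  The set of \<open>f\<close> with \<open>algorithm_at d T f \<in> Rat_maps d\<close> is Zariski open in \<open>Poly r\<close> (it is the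
  nonvanishing locus of a resultant), so over an infinite field it is Zariski dense as soon as
  it is nonempty.
\<close>

definition purely_iterative_algorithm :: "nat \<Rightarrow> nat \<Rightarrow> 'k::field algorithm \<Rightarrow> bool" where
  "purely_iterative_algorithm r d T \<longleftrightarrow>
     (\<forall>i\<le>d. mpoly_vars (fst T i) \<subseteq> {..r} \<and> mpoly_vars (snd T i) \<subseteq> {..r}) \<and>
     (\<exists>f\<in>Poly r. algorithm_at d T f \<in> Rat_maps d)"

text \<open>
  \<open>f\<close> ranges over polynomials with coefficients in \<open>K\<close>, while roots of \<open>f\<close> and points of the
  projective line are taken in the algebraically closed extension \<open>L\<close>. An open dense set of
  \<open>f\<close> may be shrunk to the domain of definition of \<open>T\<close>, so requiring that \<open>T\<close> is defined at
  the \<open>f\<close> in question is harmless.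
\<close>

definition generally_convergent ::
  "('k::field \<Rightarrow> real) \<Rightarrow> ('l::field \<Rightarrow> real) \<Rightarrow> ('k \<Rightarrow> 'l) \<Rightarrow> nat \<Rightarrow> nat \<Rightarrow> 'k algorithm \<Rightarrow> bool"
where
  "generally_convergent v w \<iota> r d T \<longleftrightarrow>
     (\<exists>U. dense_open (Poly_topology v r) U \<and>
        (\<forall>f\<in>U. algorithm_at d T f \<in> Rat_maps d \<and>
           (\<exists>W. dense_open (proj_topology w) W \<and>
              (\<forall>z\<in>W. \<exists>\<alpha>. poly (map_poly \<iota> f) \<alpha> = 0 \<and>
                 limitin (proj_topology w)
                   (\<lambda>n. (rat_apply (map_prod (map_poly \<iota>) (map_poly \<iota>) (algorithm_at d T f)) ^^ n) z)
                   (Fin \<alpha>) sequentially))))"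

lemma openin_proj_topology:
  "openin (proj_topology v) S \<longleftrightarrow>
     openin (field_topology v) {x. Fin x \<in> S} \<and>
     openin (field_topology v) {x. proj_inv (Fin x) \<in> S}"
proof -
  have "istopology (\<lambda>S.
     openin (field_topology v) {x. Fin x \<in> S} \<and>
     openin (field_topology v) {x. proj_inv (Fin x) \<in> S})" (is "istopology ?P")
    unfolding istopology_def
  proof (intro conjI allI impI)
    fix S T assume "?P S" "?P T"
    moreover have "{x. Fin x \<in> S \<inter> T} = {x. Fin x \<in> S} \<inter> {x. Fin x \<in> T}"
      "{x. proj_inv (Fin x) \<in> S \<inter> T} = {x. proj_inv (Fin x) \<in> S} \<inter> {x. proj_inv (Fin x) \<in> T}"
      by blast+
    ultimately show "openin (field_topology v) {x. Fin x \<in> S \<inter> T}"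
      "openin (field_topology v) {x. proj_inv (Fin x) \<in> S \<inter> T}"
      by (simp_all only: openin_Int)
  next
    fix \<K> assume *: "\<forall>S\<in>\<K>. ?P S"
    have "{x. Fin x \<in> \<Union>\<K>} = (\<Union>S\<in>\<K>. {x. Fin x \<in> S})"
      "{x. proj_inv (Fin x) \<in> \<Union>\<K>} = (\<Union>S\<in>\<K>. {x. proj_inv (Fin x) \<in> S})"
      by blast+
    then show "openin (field_topology v) {x. Fin x \<in> \<Union>\<K>}"
      "openin (field_topology v) {x. proj_inv (Fin x) \<in> \<Union>\<K>}"
      using * by (auto simp del: proj_inv.simps)
  qed
  then show ?thesis
    by (simp add: proj_topology_def topology_inverse')
qed

context nonarch_field
begin

lemma v_0 [simp]: "v 0 = 0"
  by (simp add: eq_0_iff)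

lemma v_1 [simp]: "v 1 = 1"
  using mult[of 1 1] eq_0_iff[of 1] by simp

lemma v_minus [simp]: "v (- x) = v x"
proof -
  have "v (-1) * v (-1) = 1"
    using mult[of "-1" "-1"] by simp
  then have "v (-1) = 1"
    using nonneg[of "-1"] square_eq_1_iff[of "v (-1)"] by auto
  then show ?thesis
    using mult[of "-1" x] by simp
qed

lemma Metric_space_v: "Metric_space UNIV (\<lambda>x y. v (x - y))"
proof
  show "v (x - y) \<ge> 0" for x y by (rule nonneg)
  show "v (x - y) = v (y - x)" for x y
    using v_minus[of "x - y"] by simp
  show "v (x - y) = 0 \<longleftrightarrow> x = y" for x y
    by (simp add: eq_0_iff)
  show "v (x - z) \<le> v (x - y) + v (y - z)" for x y z
    using ultrametric[of "x - y" "y - z"] nonneg[of "x - y"] nonneg[of "y - z"] by simp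
qed

lemma topspace_field_topology [simp]: "topspace (field_topology v) = UNIV"
  unfolding field_topology_def by (rule Metric_space.topspace_mtopology[OF Metric_space_v])

lemma topspace_proj_topology [simp]: "topspace (proj_topology v) = UNIV"
proof -
  have "openin (proj_topology v) UNIV"
    using openin_topspace[of "field_topology v"] by (simp add: openin_proj_topology)
  then show ?thesis
    using openin_subset by blast
qed

lemma topspace_Poly_topology [simp]: "topspace (Poly_topology v r) = Poly r"
  by (simp add: Poly_topology_def topspace_pullback_topology)

lemma v_of_nat_le_1: "v (of_nat n) \<le> 1"
proof (induction n)
  case (Suc n)
  then show ?case
    using ultrametric[of 1 "of_nat n"] by simp
qed simp

lemma cring_valuation_ring: "cring (valuation_ring v)"
proof (rule cringI)
  show "abelian_group (valuation_ring v)"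
  proof (rule abelian_groupI)
    fix x y assume "x \<in> carrier (valuation_ring v)" "y \<in> carrier (valuation_ring v)"
    then show "x \<oplus>\<^bsub>valuation_ring v\<^esub> y \<in> carrier (valuation_ring v)"
      using ultrametric[of x y] by (simp add: valuation_ring_def)
  next
    fix x assume "x \<in> carrier (valuation_ring v)"
    then show "\<exists>y\<in>carrier (valuation_ring v).
        y \<oplus>\<^bsub>valuation_ring v\<^esub> x = \<zero>\<^bsub>valuation_ring v\<^esub>"
      by (intro bexI[of _ "- x"]) (simp_all add: valuation_ring_def)
  qed (simp_all add: valuation_ring_def ac_simps)
  show "comm_monoid (valuation_ring v)"
    by (rule comm_monoidI)
       (auto simp: valuation_ring_def mult nonneg intro!: mult_le_one)
qed (simp add: valuation_ring_def algebra_simps)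

lemma ideal_maximal: "ideal {x. v x < 1} (valuation_ring v)"
proof -
  interpret R: cring "valuation_ring v" by (rule cring_valuation_ring)
  have inv: "\<ominus>\<^bsub>valuation_ring v\<^esub> x = - x" if "v x \<le> 1" for x
    by (rule R.minus_equality) (use that in \<open>simp_all add: valuation_ring_def\<close>)
  show ?thesis
  proof (rule idealI)
    show "ring (valuation_ring v)" ..
    show "subgroup {x. v x < 1} (add_monoid (valuation_ring v))"
    proof (rule R.add.subgroupI)
      show "{x. v x < 1} \<subseteq> carrier (valuation_ring v)" "{x. v x < 1} \<noteq> {}"
        by (auto simp: valuation_ring_def intro: exI[of _ 0])
      show "\<ominus>\<^bsub>valuation_ring v\<^esub> a \<in> {x. v x < 1}" if "a \<in> {x. v x < 1}" for a
        using that by (simp add: inv)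
      show "a \<oplus>\<^bsub>valuation_ring v\<^esub> b \<in> {x. v x < 1}"
        if "a \<in> {x. v x < 1}" "b \<in> {x. v x < 1}" for a b
        using that ultrametric[of a b] by (simp add: valuation_ring_def)
    qed
    fix a x assume "a \<in> {x. v x < 1}" "x \<in> carrier (valuation_ring v)"
    then have "v a * v x < 1"
      using nonneg[of a] nonneg[of x] mult_left_le[of "v x" "v a"] by (auto simp: valuation_ring_def)
    then show "x \<otimes>\<^bsub>valuation_ring v\<^esub> a \<in> {x. v x < 1}"
      "a \<otimes>\<^bsub>valuation_ring v\<^esub> x \<in> {x. v x < 1}"
      by (simp_all add: valuation_ring_def mult mult.commute)
  qed
qed

lemma residue_char_dvd_iff: "residue_char v dvd n \<longleftrightarrow> v (of_nat n) < 1"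
proof -
  interpret I: ideal "{x. v x < 1}" "valuation_ring v" by (rule ideal_maximal)
  interpret Q: ring "residue_field v"
    unfolding residue_field_def by (rule I.quotient_is_ring)
  have pow: "\<one>\<^bsub>residue_field v\<^esub> [^]\<^bsub>add_monoid (residue_field v)\<^esub> m =
      {x. v x < 1} +>\<^bsub>valuation_ring v\<^esub> of_nat m" for m :: nat
  proof (induction m)
    case 0
    show ?case
      by (simp add: residue_field_def FactRing_def valuation_ring_def a_r_coset_def r_coset_def)
  next
    case (Suc m)
    have "of_nat m \<in> carrier (valuation_ring v)" "1 \<in> carrier (valuation_ring v)"
      by (simp_all add: valuation_ring_def v_of_nat_le_1)
    from I.a_rcos_sum[OF this] Suc show ?case
      by (simp add: residue_field_def FactRing_def) (simp add: valuation_ring_def add.commute)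
  qed
  have "residue_char v dvd n \<longleftrightarrow>
      \<one>\<^bsub>residue_field v\<^esub> [^]\<^bsub>add_monoid (residue_field v)\<^esub> n = \<zero>\<^bsub>residue_field v\<^esub>"
    using Q.add.pow_eq_id[of "\<one>\<^bsub>residue_field v\<^esub>" n] by (simp add: residue_char_def add_pow_def)
  also have "\<dots> \<longleftrightarrow> {x. v x < 1} +>\<^bsub>valuation_ring v\<^esub> of_nat n = {x. v x < 1}"
    unfolding pow by (simp add: residue_field_def FactRing_def)
  also have "\<dots> \<longleftrightarrow> v (of_nat n) < 1"
  proof
    assume "{x. v x < 1} +>\<^bsub>valuation_ring v\<^esub> of_nat n = {x. v x < 1}"
    moreover have "of_nat n \<in> {x. v x < 1} +>\<^bsub>valuation_ring v\<^esub> of_nat n"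
      by (auto simp: a_r_coset_def r_coset_def valuation_ring_def intro!: exI[of _ 0])
    ultimately show "v (of_nat n) < 1" by blast
  next
    assume "v (of_nat n) < 1"
    then show "{x. v x < 1} +>\<^bsub>valuation_ring v\<^esub> of_nat n = {x. v x < 1}"
      by (intro I.a_rcos_const) simp
  qed
  finally show ?thesis .
qed

end

end

theory Submission
  imports Defs
begin

hide_const (open) Module.smult

text \<open>
  Suppose that \<open>T\<close> is generally convergent. For \<open>f\<close> in the open dense set of convergence, \<open>T_f\<close>
  cannot have an indifferent fixed point, because over a non-archimedean field such a point is
  surrounded by invariant spheres, and an attracting fixed point must be a root of \<open>f\<close>
  (\<open>nonrepelling_imp_attracting_root\<close>, \<open>infinity_repelling\<close>). In the fixed point formula
  \<open>\<Sum> 1 / (1 - \<lambda>) = 1\<close> the repelling fixed points contribute terms of absolute value less than \<open>1\<close>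
  and the attracting ones terms congruent to \<open>1\<close>. So the number \<open>N\<close> of attracting fixed points
  is congruent to \<open>1\<close> modulo the residue characteristic \<open>p\<close>, and clearly \<open>N \<le> d + 1\<close>
  (\<open>card_attracting\<close>, from \<open>sum_residues\<close>).

  On the other hand, the roots of a generic \<open>f\<close> play symmetric roles. The quantitative form used
  here is \<open>open_set_with_indistinguishable_roots\<close>: there is a nonempty open set of polynomials \<open>f\<close>
  such that the absolute value of \<open>E(f, \<alpha>)\<close> is the same at all roots \<open>\<alpha>\<close> of \<open>f\<close>, for each of
  finitely many given polynomials \<open>E\<close> in \<open>\<alpha>\<close> and the coefficients of \<open>f\<close>. It is obtained by
  prescribing absolute values of the coefficients so that one monomial of \<open>E\<close> dominates
  (\<open>generic_radii\<close>) while all roots of \<open>f\<close> have the same absolute value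
  (\<open>v_root_two_term_dominance\<close>). Since \<open>|\<lambda>| < 1\<close> at a fixed point is a condition on such absolute
  values, either all \<open>r\<close> roots of \<open>f\<close> are attracting fixed points or none is.

  Hence \<open>N = 0\<close>, which is impossible, or \<open>N = r\<close>. In the latter case \<open>p\<close> divides \<open>r - 1 > 0\<close>, so
  \<open>0 < p < r\<close>, and \<open>p > d\<close> would give \<open>r \<le> d + 1 \<le> p\<close>, a contradiction.
\<close>

section \<open>Bezout identity and partial fractions of polynomials\<close>

hide_const (open) Module.smult

lemma poly_eq_sum_upto:
  fixes p :: "'a::comm_semiring_1 poly"
  assumes "degree p \<le> m"
  shows "poly p x = (\<Sum>i\<le>m. coeff p i * x ^ i)"
  unfolding poly_altdef
  by (rule sum.mono_neutral_left) (use assms in \<open>auto simp: coeff_eq_0\<close>)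

text \<open>
  A nonzero element of least degree in the ideal generated by \<open>P\<close> and \<open>Q\<close> divides both, hence
  is a unit. The identity is what carries coprimality over to the larger field, where it
  rules out common roots.
\<close>

lemma bezout_poly_field:
  fixes P Q :: "'a::field poly"
  assumes "coprime P Q"
  shows "\<exists>a b. a * P + b * Q = 1"
proof -
  define I where "I = {a * P + b * Q | a b. True}"
  have lin: "x - c * y \<in> I" if "x \<in> I" "y \<in> I" for x y c
  proof -
    from that obtain a b a' b' where "x = a * P + b * Q" "y = a' * P + b' * Q"
      unfolding I_def by blast
    then have "x - c * y = (a - c * a') * P + (b - c * b') * Q"
      by (simp add: algebra_simps)
    then show ?thesis unfolding I_def by blast
  qed
  have PI: "P \<in> I" and QI: "Q \<in> I"
    unfolding I_def mem_Collect_eq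
    by (rule exI[of _ 1], rule exI[of _ 0], simp) (rule exI[of _ 0], rule exI[of _ 1], simp)
  have "P \<noteq> 0 \<or> Q \<noteq> 0"
    using assms by auto
  then have "\<exists>g. g \<in> I \<and> g \<noteq> 0"
    using PI QI by blast
  then obtain g where g: "g \<in> I" "g \<noteq> 0"
    and min: "\<And>h. h \<in> I \<Longrightarrow> h \<noteq> 0 \<Longrightarrow> degree g \<le> degree h"
    using ex_has_least_nat[of "\<lambda>g. g \<in> I \<and> g \<noteq> 0" _ degree] by blast
  have dvd: "g dvd x" if "x \<in> I" for x
  proof -
    have "x mod g \<in> I"
      using lin[OF that g(1), of "x div g"] by (simp add: minus_div_mult_eq_mod)
    then have "x mod g = 0"
      using min[of "x mod g"] degree_mod_less[OF g(2), of x] by fastforce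
    then show ?thesis by (simp add: mod_eq_0_iff_dvd)
  qed
  have "is_unit g"
    using assms dvd[OF PI] dvd[OF QI] by (rule coprime_common_divisor)
  then obtain h where "1 = g * h" by (elim dvdE)
  moreover from g(1) obtain a b where "g = a * P + b * Q"
    unfolding I_def by blast
  ultimately have "(h * a) * P + (h * b) * Q = 1"
    by (simp add: algebra_simps)
  then show ?thesis by blast
qed

lemma card_roots_eq_degree:
  fixes F :: "'a::alg_closed_field poly"
  assumes "F \<noteq> 0" and simple: "\<And>a. poly F a = 0 \<Longrightarrow> poly (pderiv F) a \<noteq> 0"
  shows "card {a. poly F a = 0} = degree F"
proof -
  obtain A where A: "size A = degree F" "F = smult (lead_coeff F) (\<Prod>x\<in>#A. [:-x, 1:])"
    using alg_closed_imp_factorization[OF \<open>F \<noteq> 0\<close>] by blast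
  have "count A a \<le> 1" for a
  proof (rule ccontr)
    assume "\<not> count A a \<le> 1"
    then have "{#a, a#} \<subseteq># A"
      by (auto simp: subseteq_mset_def)
    then obtain B where "A = {#a, a#} + B"
      by (metis subset_mset.add_diff_inverse)
    then have "F = [:-a, 1:] * ([:-a, 1:] * smult (lead_coeff F) (\<Prod>x\<in>#B. [:-x, 1:]))"
      using A(2) by (simp del: mult_pCons_left mult_pCons_right add: mult_ac)
    then obtain G where "F = [:-a, 1:] * ([:-a, 1:] * G)" by blast
    then have "poly F a = 0" "poly (pderiv F) a = 0"
      by (simp_all add: pderiv_mult del: mult_pCons_left mult_pCons_right)
    then show False using simple by blast
  qed
  then have "size A = card (set_mset A)"
    by (simp add: size_multiset_overloaded_eq)
       (metis (no_types, lifting) One_nat_def card_eq_sum count_greater_eq_one_iff le_antisym sum.cong)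
  moreover have "{a. poly F a = 0} = set_mset A"
    using \<open>F \<noteq> 0\<close> by (subst A(2)) (auto simp: poly_prod_mset prod_mset_zero_iff)
  ultimately show ?thesis using A(1) by simp
qed

text \<open>
  The sum of the residues of \<open>Q / F\<close>. For simple roots, Lagrange interpolation at the roots of
  \<open>F\<close> writes \<open>Q\<close> as \<open>\<Sum>a. (Q(a) / F'(a)) * F / (z - a)\<close>; comparing the coefficients in degree
  \<open>deg F - 1\<close> gives the claim. Applied to the fixed point polynomial below, this is the
  fixed point formula \<open>\<Sum> 1 / (1 - \<lambda>) = 1\<close> for the multipliers \<open>\<lambda>\<close> of a rational map.
\<close>

lemma sum_residues:
  fixes F Q :: "'a::alg_closed_field poly"
  assumes simple: "\<And>a. poly F a = 0 \<Longrightarrow> poly (pderiv F) a \<noteq> 0"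
    and deg: "degree Q < degree F"
  shows "(\<Sum>a\<in>{a. poly F a = 0}. poly Q a / poly (pderiv F) a) = coeff Q (degree F - 1) / lead_coeff F"
proof -
  define n where "n = degree F"
  have F0: "F \<noteq> 0" and n: "n > 0" using deg by (auto simp: n_def)
  define R where "R = {a. poly F a = 0}"
  have fin: "finite R" and card: "card R = n"
    using F0 card_roots_eq_degree[OF F0 simple] poly_roots_finite by (auto simp: R_def n_def)
  define G where "G a = F div [:-a, 1:]" for a
  have G: "F = [:-a, 1:] * G a" if "a \<in> R" for a
    using that by (simp add: R_def G_def poly_eq_0_iff_dvd del: mult_pCons_left)
  have G0: "G a \<noteq> 0" if "a \<in> R" for a using G[OF that] F0 by auto
  have dG: "degree (G a) = n - 1" and lG: "lead_coeff (G a) = lead_coeff F" if "a \<in> R" for a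
  proof -
    have "degree F = degree [:-a, 1:] + degree (G a)"
      by (subst G[OF that], subst degree_mult_eq) (use G0[OF that] in auto)
    then show "degree (G a) = n - 1" by (simp add: n_def)
    show "lead_coeff (G a) = lead_coeff F"
      using arg_cong[OF G[OF that], of lead_coeff] by (simp only: lead_coeff_mult) simp
  qed
  have Gaa: "poly (G a) a = poly (pderiv F) a" if "a \<in> R" for a
    by (subst G[OF that], subst pderiv_mult) (simp add: pderiv_pCons del: mult_pCons_left)
  have Gab: "poly (G a) b = 0" if "a \<in> R" "b \<in> R" "a \<noteq> b" for a b
  proof -
    have "poly F b = (b - a) * poly (G a) b"
      by (subst G[OF that(1)]) (simp add: pderiv_pCons del: mult_pCons_left)
    then show ?thesis using that by (simp add: R_def)
  qed
  define c where "c a = poly Q a / poly (pderiv F) a" for a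
  define S where "S = (\<Sum>a\<in>R. smult (c a) (G a))"
  have "Q = S"
  proof (rule poly_eqI_degree[of R])
    fix b assume b: "b \<in> R"
    have "poly S b = (\<Sum>a\<in>R. c a * poly (G a) b)"
      by (simp add: S_def poly_sum)
    also have "\<dots> = (\<Sum>a\<in>{b}. c a * poly (G a) b)"
      using b fin Gab by (intro sum.mono_neutral_right) auto
    also have "\<dots> = poly Q b"
      using b Gaa[OF b] simple[of b] by (simp add: c_def R_def)
    finally show "poly Q b = poly S b" ..
  next
    show "degree Q < card R" using deg card by (simp add: n_def)
    have "degree S \<le> n - 1"
      unfolding S_def by (rule degree_sum_le[OF fin]) (use dG degree_smult_le le_trans in metis)
    then show "degree S < card R" using n card by linarith
  qed
  then have "coeff Q (n - 1) = (\<Sum>a\<in>R. c a * coeff (G a) (n - 1))"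
    by (simp add: S_def coeff_sum)
  also have "\<dots> = (\<Sum>a\<in>R. c a) * lead_coeff F"
    unfolding sum_distrib_right by (rule sum.cong) (use dG lG in auto)
  finally show ?thesis using F0 by (simp add: c_def R_def n_def)
qed

section \<open>Non-archimedean estimates and topology\<close>

context nonarch_field
begin

lemma v_diff_commute: "v (x - y) = v (y - x)"
  using v_minus[of "x - y"] by simp

lemma ultrametric_diff: "v (x - y) \<le> max (v x) (v y)"
  using ultrametric[of x "- y"] by simp

lemma v_add_eq_left: "v y < v x \<Longrightarrow> v (x + y) = v x"
  using ultrametric[of x y] ultrametric_diff[of "x + y" y] by (simp add: max_def split: if_splits)

lemma v_eq_of_close: "v (y - x) < v x \<Longrightarrow> v y = v x"
  using v_add_eq_left[of "y - x" x] by simp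

lemma v_power: "v (x ^ n) = v x ^ n"
  by (induction n) (simp_all add: mult)

lemma v_inverse: "v (inverse x) = inverse (v x)"
proof (cases "x = 0")
  case False
  then have "v x * v (inverse x) = 1"
    by (metis mult right_inverse v_1)
  then show ?thesis
    by (metis inverse_unique)
qed simp

lemma v_divide: "v (x / y) = v x / v y"
  by (simp add: divide_inverse mult v_inverse)

lemma v_pos_iff: "0 < v x \<longleftrightarrow> x \<noteq> 0"
  using nonneg[of x] eq_0_iff[of x] by linarith

lemma v_sum_le:
  assumes "B \<ge> 0" "\<And>i. i \<in> A \<Longrightarrow> v (f i) \<le> B"
  shows "v (\<Sum>i\<in>A. f i) \<le> B"
  using assms(2)
proof (induction A rule: infinite_finite_induct)
  case (insert i A)
  then have "v (f i) \<le> B" "v (\<Sum>i\<in>A. f i) \<le> B" by auto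
  with insert.hyps show ?case
    using ultrametric[of "f i" "\<Sum>i\<in>A. f i"] by simp
qed (use assms(1) in auto)

lemma v_sum_less:
  assumes "finite A" "B > 0" "\<And>i. i \<in> A \<Longrightarrow> v (f i) < B"
  shows "v (\<Sum>i\<in>A. f i) < B"
  using assms(1,3)
proof (induction A rule: finite_induct)
  case (insert i A)
  then have "v (f i) < B" "v (\<Sum>i\<in>A. f i) < B" by auto
  with insert.hyps show ?case
    using ultrametric[of "f i" "\<Sum>i\<in>A. f i"] by simp
qed (use assms(2) in auto)

lemma ex_small:
  assumes "e > 0"
  shows "\<exists>x. x \<noteq> 0 \<and> v x < e"
proof -
  obtain y where y: "y \<noteq> 0" "v y \<noteq> 1" using nontrivial by blast
  define t where "t = (if v y < 1 then y else inverse y)"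
  have t: "t \<noteq> 0" "0 < v t" "v t < 1"
    using y by (auto simp: t_def v_inverse v_pos_iff inverse_less_1_iff)
  obtain n where "v t ^ n < e"
    using real_arch_pow_inv[OF assms t(3)] by blast
  then show ?thesis
    using t(1) by (intro exI[of _ "t ^ n"]) (simp add: v_power)
qed

lemma poly_continuous:
  assumes "e > 0"
  shows "\<exists>\<delta>>0. \<forall>z. v (z - a) < \<delta> \<longrightarrow> v (poly p z - poly p a) < e"
  using assms
proof (induction p arbitrary: e)
  case 0
  then show ?case by (auto intro: exI[of _ 1])
next
  case (pCons c p)
  define M where "M = v (poly p a) + 1"
  have M: "M > 0" using nonneg[of "poly p a"] by (simp add: M_def)
  have "min 1 (e / (v a + 1)) > 0" using pCons.prems nonneg[of a] by simp
  from pCons.IH[OF this] obtain \<delta> where \<delta>: "\<delta> > 0"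
    "\<And>z. v (z - a) < \<delta> \<Longrightarrow> v (poly p z - poly p a) < min 1 (e / (v a + 1))" by blast
  show ?case
  proof (intro exI[of _ "min \<delta> (e / M)"] conjI allI impI)
    show "min \<delta> (e / M) > 0" using \<delta> M pCons.prems by simp
    fix z assume z: "v (z - a) < min \<delta> (e / M)"
    have d: "v (poly p z - poly p a) < 1" "v (poly p z - poly p a) < e / (v a + 1)"
      using \<delta>(2)[of z] z by auto
    have "v (poly p z) \<le> M"
      using ultrametric[of "poly p z - poly p a" "poly p a"] d nonneg[of "poly p a"]
      by (simp add: M_def)
    then have "v (z - a) * v (poly p z) \<le> v (z - a) * M"
      by (intro mult_left_mono nonneg)
    also have "\<dots> < e" using z M by (simp add: field_simps)
    finally have 1: "v ((z - a) * poly p z) < e" by (simp add: mult)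
    have "v a * v (poly p z - poly p a) \<le> v (poly p z - poly p a) * (v a + 1)"
      using nonneg[of "poly p z - poly p a"] by (simp add: algebra_simps)
    also have "\<dots> < e" using d(2) nonneg[of a] by (simp add: field_simps)
    finally have 2: "v (a * (poly p z - poly p a)) < e" by (simp add: mult)
    have "poly (pCons c p) z - poly (pCons c p) a
        = (z - a) * poly p z + a * (poly p z - poly p a)"
      by (simp add: algebra_simps)
    then show "v (poly (pCons c p) z - poly (pCons c p) a) < e"
      using ultrametric[of "(z - a) * poly p z" "a * (poly p z - poly p a)"] 1 2 by simp
  qed
qed

text \<open>
  Absolute values of polynomials are locally constant away from the roots: a perturbation
  smaller than the value does not change the absolute value. This is why indifferent fixed
  points are surrounded by invariant spheres.
\<close>

lemma v_poly_locally_constant: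
  assumes "poly p a \<noteq> 0"
  shows "\<exists>\<delta>>0. \<forall>z. v (z - a) < \<delta> \<longrightarrow> v (poly p z) = v (poly p a)"
  using poly_continuous[of "v (poly p a)" a p] assms v_eq_of_close by (metis v_pos_iff)

lemma poly_asymptotic:
  assumes "e > 0" "degree p \<le> m"
  shows "\<exists>R\<ge>1. \<forall>z. v z > R \<longrightarrow> v (poly p z - coeff p m * z ^ m) \<le> e * v z ^ m"
proof -
  define C where "C = (\<Sum>i<m. v (coeff p i))"
  have C: "C \<ge> 0" "\<And>i. i < m \<Longrightarrow> v (coeff p i) \<le> C"
    unfolding C_def by (auto intro: sum_nonneg nonneg member_le_sum)
  show ?thesis
  proof (intro exI[of _ "max 1 (C / e)"] conjI allI impI)
    fix z assume z: "v z > max 1 (C / e)"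
    have "poly p z = (\<Sum>i\<le>m. coeff p i * z ^ i)"
      by (rule poly_eq_sum_upto) (rule assms)
    also have "\<dots> = (\<Sum>i<m. coeff p i * z ^ i) + coeff p m * z ^ m"
      by (simp add: lessThan_Suc_atMost[symmetric])
    finally have "poly p z - coeff p m * z ^ m = (\<Sum>i<m. coeff p i * z ^ i)" by simp
    also have "v \<dots> \<le> e * v z ^ m"
    proof (rule v_sum_le)
      show "0 \<le> e * v z ^ m" using assms(1) nonneg[of z] by simp
      fix i assume "i \<in> {..<m}"
      then have i: "i < m" by simp
      have "v (coeff p i) * v z ^ i \<le> C * v z ^ (m - 1)"
        using z i C nonneg by (intro mult_mono power_increasing) auto
      also have "\<dots> \<le> (e * v z) * v z ^ (m - 1)"
        using z assms(1) nonneg[of z] by (intro mult_right_mono) (auto simp: field_simps)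
      also have "\<dots> = e * v z ^ m"
        using i by (cases m) auto
      finally show "v (coeff p i * z ^ i) \<le> e * v z ^ m" by (simp add: mult v_power)
    qed
    finally show "v (poly p z - coeff p m * z ^ m) \<le> e * v z ^ m" .
  qed simp
qed

lemma openin_field_topology_iff:
  "openin (field_topology v) S \<longleftrightarrow> (\<forall>x\<in>S. \<exists>e>0. \<forall>y. v (y - x) < e \<longrightarrow> y \<in> S)"
proof -
  interpret M: Metric_space UNIV "\<lambda>x y. v (x - y)" by (rule Metric_space_v)
  show ?thesis
    unfolding field_topology_def M.openin_mtopology
    by (auto simp: M.mball_def subset_iff v_diff_commute)
qed

lemma openin_ball: "openin (field_topology v) {x. v (x - a) < e}"
  unfolding openin_field_topology_iff
proof (rule ballI)
  fix x assume x: "x \<in> {x. v (x - a) < e}"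
  have "e > 0" using x nonneg[of "x - a"] by simp
  moreover have "y \<in> {x. v (x - a) < e}" if "v (y - x) < e" for y
    using x that ultrametric[of "y - x" "x - a"] by simp
  ultimately show "\<exists>e'>0. \<forall>y. v (y - x) < e' \<longrightarrow> y \<in> {x. v (x - a) < e}" by blast
qed

lemma openin_sphere_union:
  assumes "0 \<notin> I"
  shows "openin (field_topology v) {x. v (x - a) \<in> I}"
  unfolding openin_field_topology_iff
proof (rule ballI)
  fix x assume x: "x \<in> {x. v (x - a) \<in> I}"
  have "v (x - a) > 0" using x assms nonneg[of "x - a"] by (cases "v (x - a) = 0") auto
  moreover have "y \<in> {x. v (x - a) \<in> I}" if "v (y - x) < v (x - a)" for y
    using x that v_eq_of_close[of "y - a" "x - a"] by simp
  ultimately show "\<exists>e>0. \<forall>y. v (y - x) < e \<longrightarrow> y \<in> {x. v (x - a) \<in> I}" by blast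
qed

text \<open>
  In the chart at infinity the image is \<open>{x \<noteq> 0. 1 / x \<in> V}\<close>, so the point is the continuity of
  inversion.
\<close>

lemma openin_proj_Fin_image:
  assumes "openin (field_topology v) V"
  shows "openin (proj_topology v) (Fin ` V)"
proof -
  have "{x. Fin x \<in> Fin ` V} = V" by auto
  moreover have "openin (field_topology v) {x. proj_inv (Fin x) \<in> Fin ` V}"
    unfolding openin_field_topology_iff
  proof (rule ballI)
    fix x assume "x \<in> {x. proj_inv (Fin x) \<in> Fin ` V}"
    then have x: "x \<noteq> 0" "inverse x \<in> V" by (auto split: if_splits)
    then obtain e where e: "e > 0" "\<And>y. v (y - inverse x) < e \<Longrightarrow> y \<in> V"
      using assms unfolding openin_field_topology_iff by blast
    have vx: "v x > 0" using x by (simp add: v_pos_iff)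
    show "\<exists>\<epsilon>>0. \<forall>y. v (y - x) < \<epsilon> \<longrightarrow> y \<in> {x. proj_inv (Fin x) \<in> Fin ` V}"
    proof (intro exI[of _ "min (v x) (e * v x * v x)"] conjI allI impI)
      show "0 < min (v x) (e * v x * v x)" using vx e by simp
      fix y assume y: "v (y - x) < min (v x) (e * v x * v x)"
      have vy: "v y = v x" using y by (intro v_eq_of_close) simp
      then have y0: "y \<noteq> 0" using vx by auto
      have "inverse y - inverse x = (x - y) / (y * x)"
        using x y0 by (simp add: field_simps)
      then have "v (inverse y - inverse x) = v (y - x) / (v x * v x)"
        by (simp add: v_divide mult vy v_diff_commute)
      also have "\<dots> < e" using y vx by (simp add: field_simps)
      finally show "y \<in> {x. proj_inv (Fin x) \<in> Fin ` V}"
        using e(2) y0 by auto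
    qed
  qed
  ultimately show ?thesis
    unfolding openin_proj_topology using assms by simp
qed

end

lemma dense_open_meets:
  assumes "dense_open X U" "openin X V" "V \<noteq> {}"
  shows "\<exists>x. x \<in> U \<and> x \<in> V"
  using assms unfolding dense_open_def dense_intersects_open by blast

section \<open>Fixed points of a map with convergent orbits\<close>

text \<open>
  The finite fixed points of \<open>P / Q\<close> are the roots of \<open>F = z Q - P\<close>, and at such a point \<open>a\<close> the
  multiplier \<open>\<lambda>\<close> satisfies \<open>1 - \<lambda> = F'(a) / Q(a)\<close>. Working with \<open>F\<close> and \<open>Q\<close> keeps everything
  polynomial in the coefficients of the map.
\<close>

definition fixed_point_poly :: "'a::comm_ring_1 poly \<Rightarrow> 'a poly \<Rightarrow> 'a poly" where
  "fixed_point_poly P Q = pCons 0 Q - P"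

text \<open>
  The dynamical part of the argument concerns one map \<open>T_f = P / Q\<close> at a time, over the
  algebraically closed field; how \<open>T_f\<close> depends on \<open>f\<close> enters only later.
\<close>

locale root_finding_map = nonarch_field w for w :: "'l::alg_closed_field \<Rightarrow> real" +
  fixes f P Q :: "'l poly" and d :: nat and W :: "'l proj_line set"
  assumes f_nonzero: "f \<noteq> 0"
    and degree_eq: "max (degree P) (degree Q) = d"
    and no_common_root: "poly P z \<noteq> 0 \<or> poly Q z \<noteq> 0"
    and dense: "dense_open (proj_topology w) W"
    and converges: "z0 \<in> W \<Longrightarrow> \<exists>\<alpha>. poly f \<alpha> = 0 \<and>
      limitin (proj_topology w) (\<lambda>n. (rat_apply (P, Q) ^^ n) z0) (Fin \<alpha>) sequentially"
begin

abbreviation F :: "'l poly" where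
  "F \<equiv> fixed_point_poly P Q"

lemma poly_F: "poly F a = a * poly Q a - poly P a"
  by (simp add: fixed_point_poly_def)

text \<open>
  Since \<open>\<lambda> = (Q(a) - F'(a)) / Q(a)\<close>, the inequality says \<open>|\<lambda>| < 1\<close>.
\<close>

definition attracting :: "'l \<Rightarrow> bool" where
  "attracting a \<longleftrightarrow> poly F a = 0 \<and> w (poly Q a - poly (pderiv F) a) < w (poly Q a)"

lemma degree_bounds: "degree P \<le> d" "degree Q \<le> d"
  using degree_eq by auto

lemma F_root_denominator: "poly F a = 0 \<Longrightarrow> poly Q a \<noteq> 0"
  using no_common_root[of a] by (auto simp: poly_F)

lemma orbit_reaches_root:
  assumes "z0 \<in> W"
  shows "\<exists>\<beta>. poly f \<beta> = 0 \<and> (\<forall>\<eta>>0. \<exists>n x. (rat_apply (P, Q) ^^ n) z0 = Fin x \<and> w (x - \<beta>) < \<eta>)"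
proof -
  from converges[OF assms] obtain \<beta> where \<beta>: "poly f \<beta> = 0"
    "limitin (proj_topology w) (\<lambda>n. (rat_apply (P, Q) ^^ n) z0) (Fin \<beta>) sequentially" by blast
  have "\<exists>n x. (rat_apply (P, Q) ^^ n) z0 = Fin x \<and> w (x - \<beta>) < \<eta>" if "\<eta> > 0" for \<eta>
  proof -
    have "eventually (\<lambda>n. (rat_apply (P, Q) ^^ n) z0 \<in> Fin ` {x. w (x - \<beta>) < \<eta>}) sequentially"
      using that by (intro limitinD[OF \<beta>(2)] openin_proj_Fin_image openin_ball) auto
    then obtain n where "(rat_apply (P, Q) ^^ n) z0 \<in> Fin ` {x. w (x - \<beta>) < \<eta>}"
      unfolding eventually_sequentially by blast
    then show ?thesis by blast
  qed
  with \<beta>(1) show ?thesis by blast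
qed

lemma fixed_point_local_form:
  assumes "poly F a = 0"
  shows "\<exists>S. P - smult a Q = [:-a, 1:] * S \<and> poly S a = poly Q a - poly (pderiv F) a"
proof -
  define H where "H = P - smult a Q"
  have "poly H a = 0" using assms by (simp add: H_def poly_F)
  then obtain S where S: "H = [:-a, 1:] * S"
    unfolding poly_eq_0_iff_dvd by blast
  have "poly (pderiv H) a = poly S a"
    unfolding S pderiv_mult by (simp add: pderiv_pCons del: mult_pCons_left)
  moreover have "poly (pderiv H) a = poly Q a - poly (pderiv F) a"
    by (simp add: H_def fixed_point_poly_def pderiv_diff pderiv_smult pderiv_pCons)
  ultimately show ?thesis using S unfolding H_def by metis
qed

text \<open>
  Write \<open>P - a Q = (z - a) S\<close>. Then \<open>\<phi>(z) - a = (z - a) S(z) / Q(z)\<close>, where \<open>S(a) / Q(a)\<close> is the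
  multiplier; near \<open>a\<close> the absolute values of \<open>S\<close> and \<open>Q\<close> are constant. So no point close to \<open>a\<close>
  moves away from \<open>a\<close>, and at an indifferent fixed point every small sphere is invariant.
\<close>

lemma nonrepelling_near:
  assumes fixed: "poly F a = 0"
    and nonrep: "w (poly Q a - poly (pderiv F) a) \<le> w (poly Q a)"
  shows "\<exists>\<delta>>0. \<forall>z. w (z - a) < \<delta> \<longrightarrow> (\<exists>z'. rat_apply (P, Q) (Fin z) = Fin z' \<and>
      w (z' - a) \<le> w (z - a) \<and>
      (w (poly Q a - poly (pderiv F) a) = w (poly Q a) \<longrightarrow> w (z' - a) = w (z - a)))"
proof -
  define D where "D = poly Q a - poly (pderiv F) a"
  have Qa: "poly Q a \<noteq> 0" by (rule F_root_denominator[OF fixed])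
  obtain S where S: "P - smult a Q = [:-a, 1:] * S" "poly S a = D"
    using fixed_point_local_form[OF fixed] unfolding D_def by blast
  obtain \<delta>1 where \<delta>1: "\<delta>1 > 0" "\<And>z. w (z - a) < \<delta>1 \<Longrightarrow> w (poly Q z) = w (poly Q a)"
    using v_poly_locally_constant[OF Qa] by blast
  have "\<exists>\<delta>>0. \<forall>z. w (z - a) < \<delta> \<longrightarrow>
      w (poly S z) \<le> w (poly Q a) \<and> (w D = w (poly Q a) \<longrightarrow> w (poly S z) = w (poly Q a))"
  proof (cases "D = 0")
    case True
    have "w (poly Q a) > 0" using Qa by (simp add: v_pos_iff)
    from poly_continuous[OF this, of a S] True S(2) Qa show ?thesis
      by (metis diff_zero eq_0_iff less_imp_le)
  next
    case False
    then show ?thesis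
      using v_poly_locally_constant[of S a] S(2) nonrep unfolding D_def[symmetric] by metis
  qed
  then obtain \<delta>2 where \<delta>2: "\<delta>2 > 0" "\<And>z. w (z - a) < \<delta>2 \<Longrightarrow>
      w (poly S z) \<le> w (poly Q a) \<and> (w D = w (poly Q a) \<longrightarrow> w (poly S z) = w (poly Q a))"
    by blast
  have "\<exists>z'. rat_apply (P, Q) (Fin z) = Fin z' \<and> w (z' - a) \<le> w (z - a) \<and>
      (w D = w (poly Q a) \<longrightarrow> w (z' - a) = w (z - a))"
    if z: "w (z - a) < min \<delta>1 \<delta>2" for z
  proof -
    have wQ: "w (poly Q z) = w (poly Q a)" using \<delta>1(2) z by simp
    have Qpos: "w (poly Q a) > 0" using Qa by (simp add: v_pos_iff)
    have Qz: "poly Q z \<noteq> 0" using wQ Qpos by (metis v_pos_iff)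
    have "poly (P - smult a Q) z = (z - a) * poly S z"
      unfolding S(1) by (simp add: algebra_simps)
    then have "poly P z / poly Q z - a = (z - a) * poly S z / poly Q z"
      using Qz by (simp add: field_simps)
    then have eq: "w (poly P z / poly Q z - a) = w (z - a) * (w (poly S z) / w (poly Q a))"
      by (simp add: v_divide mult wQ)
    have "w (poly S z) / w (poly Q a) \<le> 1"
      using \<delta>2(2)[of z] z Qpos by (simp add: field_simps)
    then have "w (poly P z / poly Q z - a) \<le> w (z - a)"
      unfolding eq using nonneg[of "z - a"] nonneg[of "poly S z"] Qpos
      by (intro mult_left_le) auto
    moreover have "w (poly P z / poly Q z - a) = w (z - a)" if "w D = w (poly Q a)"
      unfolding eq using \<delta>2(2)[of z] z that Qpos by simp
    ultimately show ?thesis using Qz by auto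
  qed
  then show ?thesis
    using \<delta>1(1) \<delta>2(1) unfolding D_def by (intro exI[of _ "min \<delta>1 \<delta>2"]) auto
qed

text \<open>
  Orbits starting near a nonrepelling fixed point \<open>a\<close> stay in a small disc, so the root they
  converge to is \<open>a\<close> itself. If \<open>a\<close> were indifferent, an orbit starting on a small sphere around
  \<open>a\<close> would stay on that sphere and could not converge to \<open>a\<close>.
\<close>

lemma nonrepelling_imp_attracting_root:
  assumes fixed: "poly F a = 0"
    and nonrep: "w (poly Q a - poly (pderiv F) a) \<le> w (poly Q a)"
  shows "poly f a = 0 \<and> attracting a"
proof -
  let ?\<phi> = "rat_apply (P, Q)"
  let ?indiff = "w (poly Q a - poly (pderiv F) a) = w (poly Q a)"
  obtain \<delta>1 where \<delta>1: "\<delta>1 > 0" "\<And>z. w (z - a) < \<delta>1 \<Longrightarrow>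
      \<exists>z'. ?\<phi> (Fin z) = Fin z' \<and> w (z' - a) \<le> w (z - a) \<and> (?indiff \<longrightarrow> w (z' - a) = w (z - a))"
    using nonrepelling_near[OF assms] by blast
  \<comment> \<open>The 1 only keeps the set nonempty; \<open>\<delta>2\<close> isolates \<open>a\<close> from the other roots of \<open>f\<close>.\<close>
  define \<delta>2 where "\<delta>2 = Min (insert 1 ((\<lambda>z. w (z - a)) ` ({z. poly f z = 0} - {a})))"
  have fin: "finite {z. poly f z = 0}" by (rule poly_roots_finite[OF f_nonzero])
  have "\<delta>2 > 0"
    unfolding \<delta>2_def using fin by (subst Min_gr_iff) (auto simp: v_pos_iff)
  have \<delta>2: "z = a" if "poly f z = 0" "w (z - a) < \<delta>2" for z
  proof (rule ccontr)
    assume "z \<noteq> a"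
    then have "\<delta>2 \<le> w (z - a)" unfolding \<delta>2_def using fin that by (intro Min_le) auto
    with that show False by simp
  qed
  define \<delta> where "\<delta> = min \<delta>1 \<delta>2"
  obtain b where b: "b \<noteq> 0" "w b < \<delta>"
    using ex_small[of \<delta>] \<delta>1(1) \<open>\<delta>2 > 0\<close> by (auto simp: \<delta>_def)
  have "openin (proj_topology w) (Fin ` {x. w (x - a) \<in> {0<..<\<delta>}})"
    by (intro openin_proj_Fin_image openin_sphere_union) simp
  moreover have "Fin (a + b) \<in> Fin ` {x. w (x - a) \<in> {0<..<\<delta>}}"
    using b by (simp add: v_pos_iff)
  ultimately obtain z where z: "Fin z \<in> W" "0 < w (z - a)" "w (z - a) < \<delta>"
    using dense_open_meets[OF dense, of "Fin ` {x. w (x - a) \<in> {0<..<\<delta>}}"] by auto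
  have orbit: "\<exists>x. (?\<phi> ^^ n) (Fin z) = Fin x \<and> w (x - a) \<le> w (z - a) \<and>
      (?indiff \<longrightarrow> w (x - a) = w (z - a))" for n
  proof (induction n)
    case (Suc n)
    then obtain x where x: "(?\<phi> ^^ n) (Fin z) = Fin x" "w (x - a) \<le> w (z - a)"
      "?indiff \<longrightarrow> w (x - a) = w (z - a)" by blast
    have "w (x - a) < \<delta>1" using x(2) z(3) by (simp add: \<delta>_def)
    from \<delta>1(2)[OF this] x show ?case by fastforce
  qed (use z in auto)
  obtain \<beta> where \<beta>: "poly f \<beta> = 0"
    "\<And>\<eta>. \<eta> > 0 \<Longrightarrow> \<exists>n x. (?\<phi> ^^ n) (Fin z) = Fin x \<and> w (x - \<beta>) < \<eta>"
    using orbit_reaches_root[OF z(1)] by blast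
  have "\<delta> > 0" using z by linarith
  then obtain n x where x: "(?\<phi> ^^ n) (Fin z) = Fin x" "w (x - \<beta>) < \<delta>"
    using \<beta>(2) by blast
  have "w (x - a) < \<delta>" using orbit[of n] x(1) z(3) by auto
  then have "w (\<beta> - a) < \<delta>"
    using x(2) ultrametric[of "\<beta> - x" "x - a"] by (simp add: v_diff_commute[of \<beta> x])
  then have "\<beta> = a" using \<delta>2 \<beta>(1) by (simp add: \<delta>_def)
  moreover have "\<not> ?indiff"
  proof
    assume indiff: ?indiff
    obtain n x where x: "(?\<phi> ^^ n) (Fin z) = Fin x" "w (x - \<beta>) < w (z - a)"
      using \<beta>(2)[OF z(2)] by blast
    then show False using orbit[of n] indiff \<open>\<beta> = a\<close> by auto
  qed
  ultimately show ?thesis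
    using fixed nonrep \<beta>(1) unfolding attracting_def by force
qed

text \<open>
  The point at infinity is fixed if \<open>coeff Q d = 0\<close>. For \<open>d > 0\<close> its multiplier, computed in the
  coordinate \<open>1 / z\<close>, is \<open>coeff Q (d - 1) / coeff P d\<close>. If infinity were nonrepelling, then
  \<open>|P(z) / Q(z)| \<ge> |z|\<close> for large \<open>z\<close>, and orbits starting near infinity would stay away from
  all roots of \<open>f\<close>.
\<close>

lemma infinity_repelling:
  assumes "coeff Q d = 0"
  shows "d > 0 \<and> w (coeff P d) < w (coeff Q (d - 1))"
proof (rule ccontr)
  assume neg: "\<not> (d > 0 \<and> w (coeff P d) < w (coeff Q (d - 1)))"
  let ?\<phi> = "rat_apply (P, Q)"
  define p where "p = w (coeff P d)"
  have Pd: "coeff P d \<noteq> 0"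
  proof
    assume "coeff P d = 0"
    then have "P = 0 \<or> degree P < d" "Q = 0 \<or> degree Q < d"
      using eq_zero_or_degree_less degree_bounds assms by blast+
    then have "P = 0 \<and> Q = 0" using degree_eq by (auto simp: max_def split: if_splits)
    then show False using no_common_root[of 0] by simp
  qed
  then have p: "p > 0" by (simp add: p_def v_pos_iff)
  have large: "\<exists>R\<ge>1. \<forall>z. w z > R \<longrightarrow> poly Q z = 0 \<or> w z \<le> w (poly P z / poly Q z)"
  proof -
    obtain R1 where R1: "R1 \<ge> 1"
      "\<And>z. w z > R1 \<Longrightarrow> w (poly P z - coeff P d * z ^ d) \<le> (p / 2) * w z ^ d"
      using poly_asymptotic[of "p / 2" P d] p degree_bounds by auto
    have wP: "w (poly P z) = p * w z ^ d" if "w z > R1" for z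
    proof -
      have "w z ^ d > 0" using that R1(1) by simp
      then have "(p / 2) * w z ^ d < p * w z ^ d" using p by simp
      then have "w (poly P z - coeff P d * z ^ d) < w (coeff P d * z ^ d)"
        unfolding mult v_power p_def[symmetric] using R1(2)[OF that] by linarith
      from v_eq_of_close[OF this] show ?thesis by (simp add: mult v_power p_def)
    qed
    show ?thesis
    proof (cases "d = 0")
      case True
      then have "Q = 0" using eq_zero_or_degree_less[OF degree_bounds(2) assms] by simp
      then show ?thesis by (intro exI[of _ 1]) simp
    next
      case False
      then have qle: "w (coeff Q (d - 1)) \<le> p" using neg by (simp add: p_def)
      have "degree Q \<le> d - 1"
        using eq_zero_or_degree_less[OF degree_bounds(2) assms] by auto
      then obtain R2 where R2: "R2 \<ge> 1"
        "\<And>z. w z > R2 \<Longrightarrow> w (poly Q z - coeff Q (d - 1) * z ^ (d - 1)) \<le> p * w z ^ (d - 1)"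
        using poly_asymptotic[of p Q "d - 1"] p by auto
      have "poly Q z = 0 \<or> w z \<le> w (poly P z / poly Q z)" if z: "w z > max R1 R2" for z
      proof (cases "poly Q z = 0")
        case False
        have "w (coeff Q (d - 1) * z ^ (d - 1)) \<le> p * w z ^ (d - 1)"
          using qle nonneg[of z] by (simp add: mult v_power mult_right_mono)
        then have "w (poly Q z) \<le> p * w z ^ (d - 1)"
          using R2(2)[of z] z
            ultrametric[of "poly Q z - coeff Q (d - 1) * z ^ (d - 1)" "coeff Q (d - 1) * z ^ (d - 1)"]
          by (simp only: diff_add_cancel) (simp add: max_def split: if_splits)
        then have "w z * w (poly Q z) \<le> w z * (p * w z ^ (d - 1))"
          by (intro mult_left_mono nonneg)
        also have "\<dots> = w (poly P z)"
          using wP[of z] z power_minus_mult[of d "w z"] \<open>d \<noteq> 0\<close> by (simp add: mult_ac)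
        finally show ?thesis using False v_pos_iff[of "poly Q z"]
          by (simp add: v_divide field_simps)
      qed simp
      then show ?thesis using R1(1) by (intro exI[of _ "max R1 R2"]) auto
    qed
  qed
  then obtain R1 where R1: "R1 \<ge> 1"
    "\<And>z. w z > R1 \<Longrightarrow> poly Q z = 0 \<or> w z \<le> w (poly P z / poly Q z)" by blast
  define R where "R = Max (insert R1 (w ` {z. poly f z = 0}))"
  have fin: "finite {z. poly f z = 0}" by (rule poly_roots_finite[OF f_nonzero])
  have Rf: "w z \<le> R" if "poly f z = 0" for z
    unfolding R_def using fin that by (intro Max_ge) auto
  have RR1: "R1 \<le> R" unfolding R_def using fin by (intro Max_ge) auto
  have inf_fixed: "?\<phi> Infty = Infty" using assms degree_eq by (simp add: Let_def)
  obtain t where t: "t \<noteq> 0" "w t < 1 / R" using ex_small[of "1 / R"] R1(1) RR1 by auto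
  have "w (inverse t) > R"
    unfolding v_inverse using t v_pos_iff[of t] R1(1) RR1 by (simp add: field_simps)
  then have "Fin (inverse t) \<in> Fin ` {x. w (x - 0) \<in> {R<..}}" by simp
  moreover have "openin (proj_topology w) (Fin ` {x. w (x - 0) \<in> {R<..}})"
    using R1(1) RR1 by (intro openin_proj_Fin_image openin_sphere_union) simp
  ultimately obtain z where z: "Fin z \<in> W" "w z > R"
    using dense_open_meets[OF dense, of "Fin ` {x. w (x - 0) \<in> {R<..}}"] by auto
  have orbit: "w x > R" if "(?\<phi> ^^ n) (Fin z) = Fin x" for n x
    using that
  proof (induction n arbitrary: x)
    case (Suc n)
    show ?case
    proof (cases "(?\<phi> ^^ n) (Fin z)")
      case (Fin y)
      then have "w y > R" by (rule Suc.IH)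
      moreover from Suc.prems Fin have "poly Q y \<noteq> 0" "x = poly P y / poly Q y"
        by (auto split: if_splits)
      ultimately show ?thesis using R1(2)[of y] RR1 by auto
    next
      case Infty
      then show ?thesis using Suc.prems inf_fixed by simp
    qed
  qed (use z in auto)
  obtain \<beta> where \<beta>: "poly f \<beta> = 0"
    "\<And>\<eta>. \<eta> > 0 \<Longrightarrow> \<exists>n x. (?\<phi> ^^ n) (Fin z) = Fin x \<and> w (x - \<beta>) < \<eta>"
    using orbit_reaches_root[OF z(1)] by blast
  obtain n x where x: "(?\<phi> ^^ n) (Fin z) = Fin x" "w (x - \<beta>) < 1"
    using \<beta>(2)[of 1] by auto
  have "w x \<le> R"
    using ultrametric[of "x - \<beta>" \<beta>] x(2) Rf[OF \<beta>(1)] R1(1) RR1 by simp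
  then show False using orbit[OF x(1)] by simp
qed

lemma F_simple_root: "poly F a = 0 \<Longrightarrow> poly (pderiv F) a \<noteq> 0"
  using nonrepelling_imp_attracting_root[of a] by (auto simp: attracting_def)

text \<open>
  In the fixed point formula \<open>\<Sum> 1 / (1 - \<lambda>) = 1\<close>, a repelling fixed point contributes a term of
  absolute value less than \<open>1\<close>, and an attracting one a term congruent to \<open>1\<close> modulo the maximal
  ideal. Hence the number of attracting fixed points is congruent to \<open>1\<close> in the residue field.
  The finite part of the formula is \<open>sum_residues\<close> for \<open>Q / F\<close>; a repelling fixed point at
  infinity does not disturb the congruence.
\<close>

lemma card_attracting:
  "w (of_nat (card {a. attracting a}) - 1) < 1"
  "card {a. attracting a} \<le> d + 1"
proof -
  define n where "n = degree F"
  have cF: "coeff F (Suc d) = coeff Q d" "coeff F d = (if d = 0 then 0 else coeff Q (d - 1)) - coeff P d"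
    using degree_bounds by (auto simp: fixed_point_poly_def coeff_pCons coeff_eq_0 split: nat.split)
  have dF: "degree F \<le> Suc d"
    unfolding fixed_point_poly_def using degree_bounds
    by (intro degree_diff_le) (auto intro: le_trans[OF degree_pCons_le])
  \<comment> \<open>The sum over the finite fixed points is congruent to 1. It is exactly 1 if infinity is not
    fixed; otherwise \<open>F\<close> has degree \<open>d\<close> and infinity accounts for the small difference.\<close>
  have main: "degree Q < degree F \<and> w (coeff Q (degree F - 1) / lead_coeff F - 1) < 1"
  proof (cases "coeff Q d = 0")
    case False
    then have "degree F = Suc d"
      using dF cF by (metis le_antisym le_degree)
    then show ?thesis using False cF degree_bounds by simp
  next
    case True
    then have d: "d > 0" and less: "w (coeff P d) < w (coeff Q (d - 1))"
      using infinity_repelling by auto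
    have lead: "w (coeff F d) = w (coeff Q (d - 1))"
      using v_add_eq_left[of "- coeff P d" "coeff Q (d - 1)"] less d cF(2) by simp
    then have nz: "coeff F d \<noteq> 0" using less nonneg[of "coeff P d"] by auto
    then have deg: "degree F = d"
      using dF cF(1) True by (metis le_SucE le_antisym le_degree leading_coeff_0_iff degree_0 coeff_0)
    have "degree Q < d"
      using eq_zero_or_degree_less[OF degree_bounds(2) True] d by auto
    moreover have "coeff Q (d - 1) / coeff F d - 1 = (coeff Q (d - 1) - coeff F d) / coeff F d"
      using nz by (metis diff_divide_distrib divide_self)
    moreover have "coeff Q (d - 1) - coeff F d = coeff P d"
      unfolding cF(2) using d by (simp only: if_not_P[OF less_imp_neq[symmetric]] diff_diff_eq2 add_diff_cancel_left')
    ultimately have "degree Q < d" "w (coeff Q (d - 1) / coeff F d - 1) < 1"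
      using less lead nonneg[of "coeff P d"] by (simp_all add: v_divide)
    then show ?thesis using deg by simp
  qed
  then have F0: "F \<noteq> 0" by auto
  define R where "R = {a. poly F a = 0}"
  have finR: "finite R" unfolding R_def by (rule poly_roots_finite[OF F0])
  define A where "A = {a. attracting a}"
  have AR: "A \<subseteq> R" by (auto simp: A_def R_def attracting_def)
  define g where "g a = poly Q a / poly (pderiv F) a" for a
  have gA: "w (g a - 1) < 1" if "a \<in> A" for a
  proof -
    have less: "w (poly Q a - poly (pderiv F) a) < w (poly Q a)" and F: "poly F a = 0"
      using that by (auto simp: A_def attracting_def)
    have "w (poly (pderiv F) a) = w (poly Q a)"
      using v_eq_of_close[of "poly (pderiv F) a" "poly Q a"] less by (simp add: v_diff_commute)
    moreover have "g a - 1 = (poly Q a - poly (pderiv F) a) / poly (pderiv F) a"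
      using F_simple_root[OF F] by (simp add: g_def field_simps)
    ultimately show ?thesis
      using less nonneg[of "poly Q a - poly (pderiv F) a"] by (simp add: v_divide)
  qed
  have gR: "w (g a) < 1" if "a \<in> R - A" for a
  proof -
    have F: "poly F a = 0" using that by (simp add: R_def)
    have less: "w (poly Q a) < w (poly Q a - poly (pderiv F) a)"
      using nonrepelling_imp_attracting_root[OF F] that by (force simp: A_def)
    have "w (poly (pderiv F) a) > w (poly Q a)"
      using less ultrametric_diff[of "poly Q a" "poly (pderiv F) a"] by simp
    then show ?thesis using nonneg[of "poly Q a"] by (simp add: g_def v_divide)
  qed
  have finA: "finite A" using AR finR by (rule finite_subset)
  have "(\<Sum>a\<in>R. g a) = (\<Sum>a\<in>A. g a) + (\<Sum>a\<in>R - A. g a)"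
    using AR finR by (simp add: sum.subset_diff add.commute)
  also have "(\<Sum>a\<in>A. g a) = (\<Sum>a\<in>A. g a - 1) + of_nat (card A)"
    by (simp add: sum_subtractf)
  finally have eq: "of_nat (card A) - 1 =
      ((\<Sum>a\<in>R. g a) - 1) - ((\<Sum>a\<in>A. g a - 1) + (\<Sum>a\<in>R - A. g a))"
    by (simp add: algebra_simps)
  have "w ((\<Sum>a\<in>R. g a) - 1) < 1"
    using sum_residues[of F Q] F_simple_root main unfolding R_def g_def by simp
  moreover have "w ((\<Sum>a\<in>A. g a - 1) + (\<Sum>a\<in>R - A. g a)) < 1"
  proof -
    have "w (\<Sum>a\<in>A. g a - 1) < 1" by (rule v_sum_less) (use finA gA in auto)
    moreover have "w (\<Sum>a\<in>R - A. g a) < 1" by (rule v_sum_less) (use finR gR in auto)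
    ultimately show ?thesis
      using ultrametric[of "\<Sum>a\<in>A. g a - 1" "\<Sum>a\<in>R - A. g a"] by simp
  qed
  ultimately show "w (of_nat (card {a. attracting a}) - 1) < 1"
    using ultrametric_diff unfolding A_def[symmetric] eq by (metis max_less_iff_conj le_less_trans)
  have "card A \<le> card R" using AR finR by (rule card_mono[rotated])
  also have "\<dots> \<le> degree F" unfolding R_def by (rule card_poly_roots_bound[OF F0])
  finally show "card {a. attracting a} \<le> d + 1" using dF by (simp add: A_def)
qed

end

section \<open>Polynomial functions of constant absolute value\<close>

text \<open>
  Polynomial functions of the first \<open>n\<close> variables. Working with functions rather than with
  formal polynomials makes the substitutions below mere compositions.
\<close>

inductive polynomial_fun :: "nat \<Rightarrow> ((nat \<Rightarrow> 'a::comm_ring_1) \<Rightarrow> 'a) \<Rightarrow> bool" for n where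
  const: "polynomial_fun n (\<lambda>x. c)"
| var: "i < n \<Longrightarrow> polynomial_fun n (\<lambda>x. x i)"
| add: "polynomial_fun n g \<Longrightarrow> polynomial_fun n h \<Longrightarrow> polynomial_fun n (\<lambda>x. g x + h x)"
| mult: "polynomial_fun n g \<Longrightarrow> polynomial_fun n h \<Longrightarrow> polynomial_fun n (\<lambda>x. g x * h x)"

lemma polynomial_fun_uminus: "polynomial_fun n g \<Longrightarrow> polynomial_fun n (\<lambda>x. - g x)"
  using polynomial_fun.mult[OF polynomial_fun.const[of n "-1"], of g] by simp

lemma polynomial_fun_diff:
  "polynomial_fun n g \<Longrightarrow> polynomial_fun n h \<Longrightarrow> polynomial_fun n (\<lambda>x. g x - h x)"
  using polynomial_fun.add[OF _ polynomial_fun_uminus, of n g h] by simp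

lemma polynomial_fun_sum:
  "(\<And>i. i \<in> A \<Longrightarrow> polynomial_fun n (g i)) \<Longrightarrow> polynomial_fun n (\<lambda>x. \<Sum>i\<in>A. g i x)"
  by (induction A rule: infinite_finite_induct) (auto intro: polynomial_fun.intros)

lemma polynomial_fun_prod:
  "(\<And>i. i \<in> A \<Longrightarrow> polynomial_fun n (g i)) \<Longrightarrow> polynomial_fun n (\<lambda>x. \<Prod>i\<in>A. g i x)"
  by (induction A rule: infinite_finite_induct) (auto intro: polynomial_fun.intros)

lemma polynomial_fun_power: "polynomial_fun n g \<Longrightarrow> polynomial_fun n (\<lambda>x. g x ^ k)"
  by (induction k) (auto intro: polynomial_fun.intros)

lemmas polynomial_fun_intros = polynomial_fun.intros polynomial_fun_uminus polynomial_fun_diff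
  polynomial_fun_sum polynomial_fun_prod polynomial_fun_power

lemma polynomial_fun_compose:
  assumes "polynomial_fun m E" "\<And>i. i < m \<Longrightarrow> polynomial_fun n (\<lambda>x. s x i)"
  shows "polynomial_fun n (\<lambda>x. E (s x))"
  using assms(1) by induction (auto intro: polynomial_fun.intros assms(2))

lemma polynomial_fun_poly:
  assumes "\<And>j. polynomial_fun n (\<lambda>x. coeff (G x) j)" "\<And>x. degree (G x) \<le> m" "polynomial_fun n e"
  shows "polynomial_fun n (\<lambda>x. poly (G x) (e x))"
proof -
  have "poly (G x) (e x) = (\<Sum>j\<le>m. coeff (G x) j * e x ^ j)" for x
    using assms(2) by (rule poly_eq_sum_upto)
  then show ?thesis using assms by (simp add: polynomial_fun_intros)
qed

lemma polynomial_fun_0_const: "polynomial_fun 0 E \<Longrightarrow> \<exists>c. \<forall>x. E x = c"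
  by (induction rule: polynomial_fun.induct) auto

text \<open>
  A polynomial function of \<open>n + 1\<close> variables is a polynomial in the last variable, with
  coefficients that are polynomial functions of the first \<open>n\<close>. The bound on the degree has to be
  uniform, so that only finitely many coefficient functions occur.
\<close>

lemma polynomial_fun_Suc_expand:
  assumes "polynomial_fun (Suc n) E"
  shows "\<exists>G m. (\<forall>j. polynomial_fun n (\<lambda>x. coeff (G x) j)) \<and>
    (\<forall>x. degree (G x) \<le> m \<and> E x = poly (G x) (x n))"
  using assms
proof induction
  case (const c)
  show ?case
    by (rule exI[of _ "\<lambda>x. [:c:]"], rule exI[of _ 0]) (auto intro: polynomial_fun.const)
next
  case (var i)
  show ?case
  proof (cases "i = n")
    case True
    then show ?thesis
      by (intro exI[of _ "\<lambda>x. [:0, 1:]"] exI[of _ 1]) (auto intro: polynomial_fun.const)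
  next
    case False
    then have "i < n" using var by simp
    then have "polynomial_fun n (\<lambda>x. coeff [:x i:] j)" for j
      by (cases j) (auto intro: polynomial_fun.intros)
    then show ?thesis
      by (intro exI[of _ "\<lambda>x. [:x i:]"] exI[of _ 0]) auto
  qed
next
  case (add g h)
  then obtain G H mG mH where
    "\<And>j. polynomial_fun n (\<lambda>x. coeff (G x) j)" "\<And>j. polynomial_fun n (\<lambda>x. coeff (H x) j)"
    "\<And>x. degree (G x) \<le> mG \<and> g x = poly (G x) (x n)"
    "\<And>x. degree (H x) \<le> mH \<and> h x = poly (H x) (x n)" by metis
  then show ?case
    by (intro exI[of _ "\<lambda>x. G x + H x"] exI[of _ "max mG mH"])
       (simp add: polynomial_fun.add degree_add_le max.coboundedI1 max.coboundedI2)
next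
  case (mult g h)
  then obtain G H mG mH where
    "\<And>j. polynomial_fun n (\<lambda>x. coeff (G x) j)" "\<And>j. polynomial_fun n (\<lambda>x. coeff (H x) j)"
    "\<And>x. degree (G x) \<le> mG \<and> g x = poly (G x) (x n)"
    "\<And>x. degree (H x) \<le> mH \<and> h x = poly (H x) (x n)" by metis
  note GH = this
  have "polynomial_fun n (\<lambda>x. coeff (G x * H x) j)" for j
    unfolding coeff_mult by (intro polynomial_fun_sum polynomial_fun.mult GH)
  moreover have "degree (G x * H x) \<le> mG + mH" for x
    using degree_mult_le[of "G x" "H x"] GH(3,4)[of x] by linarith
  ultimately show ?case
    using GH(3,4) by (intro exI[of _ "\<lambda>x. G x * H x"] exI[of _ "mG + mH"]) simp
qed

context nonarch_field
begin

text \<open>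
  Close to \<open>0\<close> the lowest nonvanishing term of a polynomial dominates, and how close is close
  enough depends on the absolute values of the coefficients alone.
\<close>

lemma v_poly_constant_on_small_spheres:
  assumes c: "\<And>j. c j \<ge> (0::real)" and nz: "\<exists>j. c j \<noteq> 0" and top: "\<And>j. j > m \<Longrightarrow> c j = 0"
  shows "eventually (\<lambda>s. \<exists>C>0. \<forall>p y. (\<forall>j. v (coeff p j) = c j) \<longrightarrow> v y = s \<longrightarrow> v (poly p y) = C)
    (at_right 0)"
proof -
  \<comment> \<open>\<open>k\<close> is the index of the dominant term; the radius \<open>c k / B\<close> makes it beat all higher terms.\<close>
  define k where "k = (LEAST j. c j \<noteq> 0)"
  have k: "c k \<noteq> 0" "\<And>j. j < k \<Longrightarrow> c j = 0"
    unfolding k_def by (rule LeastI_ex[OF nz]) (use not_less_Least in blast)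
  then have ck: "c k > 0" using c[of k] by simp
  define B where "B = (\<Sum>j\<le>m. c j)"
  have cB: "c j \<le> B" for j
  proof (cases "j \<le> m")
    case True
    then show ?thesis unfolding B_def using c by (intro member_le_sum) auto
  next
    case False
    then show ?thesis unfolding B_def using c top[of j] by (simp add: sum_nonneg)
  qed
  have B: "B > 0" using ck cB[of k] by simp
  have "v (poly p y) = c k * s ^ k"
    if s: "0 < s" "s < min 1 (c k / B)" and p: "\<And>j. v (coeff p j) = c j" and y: "v y = s" for s p y
  proof -
    have "degree p \<le> m" using p top by (intro degree_le) (metis eq_0_iff)
    have "k \<le> m" using k(1) top not_le by blast
    have "poly p y = (\<Sum>j\<le>m. coeff p j * y ^ j)"
      using \<open>degree p \<le> m\<close> by (rule poly_eq_sum_upto)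
    also have "\<dots> = coeff p k * y ^ k + (\<Sum>j\<in>{..m} - {k}. coeff p j * y ^ j)"
      using \<open>k \<le> m\<close> by (subst sum.remove[of _ k]) auto
    finally have eq: "poly p y = coeff p k * y ^ k + (\<Sum>j\<in>{..m} - {k}. coeff p j * y ^ j)" .
    have dom: "v (coeff p k * y ^ k) = c k * s ^ k" by (simp add: mult v_power p y)
    have "v (\<Sum>j\<in>{..m} - {k}. coeff p j * y ^ j) < c k * s ^ k"
    proof (rule v_sum_less)
      fix j assume j: "j \<in> {..m} - {k}"
      show "v (coeff p j * y ^ j) < c k * s ^ k"
      proof (cases "j < k")
        case True
        then show ?thesis using k(2)[of j] p[of j] ck s by (simp add: mult)
      next
        case False
        then have "j \<ge> Suc k" using j by simp
        then have "c j * s ^ j \<le> B * s ^ Suc k"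
          using s c[of j] cB[of j] by (intro mult_mono power_decreasing) auto
        also have "\<dots> = (B * s) * s ^ k" by simp
        also have "\<dots> < c k * s ^ k"
          using s B by (intro mult_strict_right_mono) (auto simp: field_simps)
        finally show ?thesis by (simp add: mult v_power p y)
      qed
    qed (use ck s in auto)
    then show ?thesis unfolding eq using dom v_add_eq_left by metis
  qed
  then have "\<exists>C>0. \<forall>p y. (\<forall>j. v (coeff p j) = c j) \<longrightarrow> v y = s \<longrightarrow> v (poly p y) = C"
    if "0 < s" "s < min 1 (c k / B)" for s
    using that ck by (intro exI[of _ "c k * s ^ k"]) auto
  moreover have "0 < min 1 (c k / B)" using ck B by simp
  ultimately show ?thesis
    unfolding eventually_at_right_field by blast
qed

definition sphere_tuples :: "nat \<Rightarrow> (nat \<Rightarrow> real) \<Rightarrow> (nat \<Rightarrow> 'k) set" where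
  "sphere_tuples n \<rho> = {x. \<forall>i<n. v (x i) = \<rho> i}"

text \<open>
  Given finitely many polynomial functions, there are radii such that each of them is either
  identically zero or of constant nonzero absolute value on the product of the spheres with
  these radii. The radii are chosen one variable after another, each very small compared with
  the previous ones: by induction the coefficients with respect to the last variable are zero or
  of constant absolute value, and then their lowest nonzero term dominates. The set \<open>\<Gamma>\<close> lets the
  radii be taken in the value group of a subfield, and \<open>b\<close> imposes further smallness conditions
  that depend on the radii already chosen.
\<close>

lemma generic_radii:
  fixes \<Gamma> :: "real set" and b :: "nat \<Rightarrow> (nat \<Rightarrow> real) \<Rightarrow> real"
  assumes \<Gamma>: "\<And>e. e > 0 \<Longrightarrow> \<exists>s\<in>\<Gamma>. 0 < s \<and> s < e"
    and b_pos: "\<And>i \<rho>. (\<And>j. j < i \<Longrightarrow> \<rho> j > 0) \<Longrightarrow> b i \<rho> > 0"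
    and b_cong: "\<And>i \<rho> \<rho>'. (\<And>j. j < i \<Longrightarrow> \<rho> j = \<rho>' j) \<Longrightarrow> b i \<rho> = b i \<rho>'"
    and "finite \<E>" "\<And>E. E \<in> \<E> \<Longrightarrow> polynomial_fun n E"
  shows "\<exists>\<rho>. (\<forall>i<n. \<rho> i \<in> \<Gamma> \<and> 0 < \<rho> i \<and> \<rho> i < b i \<rho>) \<and>
    (\<forall>E\<in>\<E>. (\<forall>x. E x = 0) \<or> (\<exists>C>0. \<forall>x\<in>sphere_tuples n \<rho>. v (E x) = C))"
  using assms(4,5)
proof (induction n arbitrary: \<E>)
  case 0
  have "(\<forall>x. E x = 0) \<or> (\<exists>C>0. \<forall>x. v (E x) = C)" if "E \<in> \<E>" for E
  proof -
    obtain c where c: "\<And>x. E x = c" using polynomial_fun_0_const[OF 0(2)[OF \<open>E \<in> \<E>\<close>]] by blast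
    show ?thesis
      by (cases "c = 0") (auto simp: c v_pos_iff)
  qed
  then show ?case by (auto simp: sphere_tuples_def)
next
  case (Suc n)
  have "\<forall>E. \<exists>Gm. E \<in> \<E> \<longrightarrow> (\<forall>j. polynomial_fun n (\<lambda>x. coeff (fst Gm x) j)) \<and>
      (\<forall>x. degree (fst Gm x) \<le> snd Gm \<and> E x = poly (fst Gm x) (x n))"
  proof
    fix E
    show "\<exists>Gm. E \<in> \<E> \<longrightarrow> (\<forall>j. polynomial_fun n (\<lambda>x. coeff (fst Gm x) j)) \<and>
      (\<forall>x. degree (fst Gm x) \<le> snd Gm \<and> E x = poly (fst Gm x) (x n))"
    proof (cases "E \<in> \<E>")
      case True
      from polynomial_fun_Suc_expand[OF Suc.prems(2)[OF True]] show ?thesis by simp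
    qed simp
  qed
  from choice[OF this] obtain Gm where Gm: "\<forall>E. E \<in> \<E> \<longrightarrow>
      (\<forall>j. polynomial_fun n (\<lambda>x. coeff (fst (Gm E) x) j)) \<and>
      (\<forall>x. degree (fst (Gm E) x) \<le> snd (Gm E) \<and> E x = poly (fst (Gm E) x) (x n))"
    by (rule exE)
  define G where "G E = fst (Gm E)" for E
  define m where "m E = snd (Gm E)" for E
  have G: "polynomial_fun n (\<lambda>x. coeff (G E x) j)"
    and deg: "degree (G E x) \<le> m E" and eq: "E x = poly (G E x) (x n)"
    if "E \<in> \<E>" for E j x
    using mp[OF spec[OF Gm] that] by (simp_all add: G_def m_def)
  define \<C> where "\<C> = (\<Union>E\<in>\<E>. (\<lambda>j x. coeff (G E x) j) ` {..m E})"
  have "finite \<C>" using Suc.prems(1) by (simp add: \<C>_def)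
  moreover have "polynomial_fun n g" if "g \<in> \<C>" for g using that G by (auto simp: \<C>_def)
  ultimately have "\<exists>\<rho>. (\<forall>i<n. \<rho> i \<in> \<Gamma> \<and> 0 < \<rho> i \<and> \<rho> i < b i \<rho>) \<and>
      (\<forall>g\<in>\<C>. (\<forall>x. g x = 0) \<or> (\<exists>C>0. \<forall>x\<in>sphere_tuples n \<rho>. v (g x) = C))"
    by (rule Suc.IH)
  then obtain \<rho> where \<rho>: "\<forall>i<n. \<rho> i \<in> \<Gamma> \<and> 0 < \<rho> i \<and> \<rho> i < b i \<rho>"
    and dich: "\<forall>g\<in>\<C>. (\<forall>x. g x = 0) \<or> (\<exists>C>0. \<forall>x\<in>sphere_tuples n \<rho>. v (g x) = C)"
    by (elim exE conjE)
  define good where "good E s \<longleftrightarrow> (\<forall>x. E x = 0) \<or>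
    (\<exists>C>0. \<forall>x\<in>sphere_tuples n \<rho>. v (x n) = s \<longrightarrow> v (E x) = C)" for E s
  have "eventually (good E) (at_right 0)" if E: "E \<in> \<E>" for E
  proof (cases "\<forall>x. G E x = 0")
    case True
    then show ?thesis
      using eq[OF E] by (intro always_eventually) (simp add: good_def)
  next
    case False
    have "\<exists>C\<ge>0. (C = 0 \<longleftrightarrow> (\<forall>x. coeff (G E x) j = 0)) \<and>
        (\<forall>x\<in>sphere_tuples n \<rho>. v (coeff (G E x) j) = C)" for j
    proof (cases "\<forall>x. coeff (G E x) j = 0")
      case True
      then show ?thesis by (intro exI[of _ 0]) auto
    next
      case False
      then have "j \<le> m E" using deg[OF E] by (auto intro: order_trans[OF le_degree])
      then have "(\<lambda>x. coeff (G E x) j) \<in> \<C>" using E by (auto simp: \<C>_def)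
      from bspec[OF dich this] False obtain C
        where "C > 0" "\<forall>x\<in>sphere_tuples n \<rho>. v (coeff (G E x) j) = C" by blast
      then show ?thesis using False by (intro exI[of _ C]) auto
    qed
    then have "\<exists>c. \<forall>j. c j \<ge> 0 \<and> (c j = 0 \<longleftrightarrow> (\<forall>x. coeff (G E x) j = 0)) \<and>
        (\<forall>x\<in>sphere_tuples n \<rho>. v (coeff (G E x) j) = c j)"
      by (intro choice) blast
    then obtain c where c: "\<And>j. c j \<ge> 0" "\<And>j. c j = 0 \<longleftrightarrow> (\<forall>x. coeff (G E x) j = 0)"
      "\<And>j x. x \<in> sphere_tuples n \<rho> \<Longrightarrow> v (coeff (G E x) j) = c j"
      by blast
    obtain x where "G E x \<noteq> 0" using False by blast
    then have "c (degree (G E x)) \<noteq> 0" unfolding c(2) using leading_coeff_0_iff by blast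
    then have "\<exists>j. c j \<noteq> 0" by blast
    moreover have "c j = 0" if "j > m E" for j
      unfolding c(2) using deg[OF E] that by (intro allI coeff_eq_0) (rule le_less_trans)
    ultimately have "eventually (\<lambda>s. \<exists>C>0. \<forall>p y. (\<forall>j. v (coeff p j) = c j) \<longrightarrow> v y = s \<longrightarrow>
        v (poly p y) = C) (at_right 0)"
      by (intro v_poly_constant_on_small_spheres[of c "m E"] c(1))
    then show ?thesis
    proof (rule eventually_mono)
      fix s assume "\<exists>C>0. \<forall>p y. (\<forall>j. v (coeff p j) = c j) \<longrightarrow> v y = s \<longrightarrow> v (poly p y) = C"
      then obtain C where C: "C > 0"
        "\<And>p y. \<forall>j. v (coeff p j) = c j \<Longrightarrow> v y = s \<Longrightarrow> v (poly p y) = C" by blast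
      have "v (E x) = C" if "x \<in> sphere_tuples n \<rho>" "v (x n) = s" for x
        unfolding eq[OF E, of x] using that c(3) by (intro C(2)) auto
      then show "good E s" unfolding good_def using C(1) by blast
    qed
  qed
  then have "eventually (\<lambda>s. \<forall>E\<in>\<E>. good E s) (at_right 0)"
    using Suc.prems(1) by (simp add: eventually_ball_finite)
  then obtain \<delta> where \<delta>: "\<delta> > 0" "\<And>s E. 0 < s \<Longrightarrow> s < \<delta> \<Longrightarrow> E \<in> \<E> \<Longrightarrow> good E s"
    unfolding eventually_at_right_field by blast
  have "b n \<rho> > 0" using \<rho>(1) by (intro b_pos) auto
  then obtain s where s: "s \<in> \<Gamma>" "0 < s" "s < \<delta>" "s < b n \<rho>"
    using \<Gamma>[of "min \<delta> (b n \<rho>)"] \<delta>(1) by auto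
  have bb: "b i (\<rho>(n := s)) = b i \<rho>" if "i \<le> n" for i
    using that by (intro b_cong) auto
  show ?case
  proof (intro exI[of _ "\<rho>(n := s)"] conjI allI impI ballI)
    fix i assume "i < Suc n"
    then show "(\<rho>(n := s)) i \<in> \<Gamma>" "0 < (\<rho>(n := s)) i" "(\<rho>(n := s)) i < b i (\<rho>(n := s))"
      using \<rho>(1) s bb[of i] by (auto simp: less_Suc_eq)
  next
    fix E assume E: "E \<in> \<E>"
    have "x \<in> sphere_tuples n \<rho> \<and> v (x n) = s" if "x \<in> sphere_tuples (Suc n) (\<rho>(n := s))" for x
      using that by (auto simp: sphere_tuples_def less_Suc_eq split: if_splits)
    then show "(\<forall>x. E x = 0) \<or> (\<exists>C>0. \<forall>x\<in>sphere_tuples (Suc n) (\<rho>(n := s)). v (E x) = C)"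
      using \<delta>(2)[OF s(2,3) E] unfolding good_def by blast
  qed
qed

end

section \<open>Polynomials with indistinguishable roots\<close>

context nonarch_field
begin

lemma openin_Poly_topology_spheres:
  assumes "\<And>i. i \<le> r \<Longrightarrow> s i > 0"
  shows "openin (Poly_topology v r) {f \<in> Poly r. \<forall>i\<le>r. v (coeff f i) = s i}"
proof -
  define X where "X i = (if i \<le> r then {x. v x = s i} else UNIV)" for i
  have "openin (field_topology v) (X i)" for i
  proof (cases "i \<le> r")
    case True
    then have "openin (field_topology v) {x. v (x - 0) \<in> {s i}}"
      using assms[of i] by (intro openin_sphere_union) simp
    then show ?thesis using True by (simp add: X_def)
  next
    case False
    then show ?thesis
      using openin_topspace[of "field_topology v"] by (simp add: X_def)
  qed
  moreover have "finite {i. X i \<noteq> topspace (field_topology v)}"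
    by (rule finite_subset[of _ "{..r}"]) (auto simp: X_def split: if_splits)
  ultimately have "openin (product_topology (\<lambda>_. field_topology v) UNIV) (PiE UNIV X)"
    by (rule product_topology_basis)
  moreover have "{f \<in> Poly r. \<forall>i\<le>r. v (coeff f i) = s i} = coeff -` (PiE UNIV X) \<inter> Poly r"
    by (auto simp: PiE_UNIV_domain X_def split: if_splits)
  ultimately show ?thesis
    unfolding Poly_topology_def openin_pullback_topology by blast
qed

lemma ex_poly_on_spheres:
  assumes "\<And>i. i \<le> r \<Longrightarrow> s i \<in> range v" "s r > 0"
  shows "{f \<in> Poly r. \<forall>i\<le>r. v (coeff f i) = s i} \<noteq> {}"
proof -
  define t where "t i = inv_into UNIV v (s i)" for i
  have t: "v (t i) = s i" if "i \<le> r" for i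
    unfolding t_def using assms(1)[OF that] by (rule f_inv_into_f)
  define f where "f = (\<Sum>i\<le>r. monom (t i) i)"
  have cf: "coeff f i = (if i \<le> r then t i else 0)" for i
    by (simp add: f_def coeff_sum)
  have "t r \<noteq> 0" using t[of r] assms(2) by auto
  then have "degree f = r"
    by (intro antisym degree_le le_degree) (auto simp: cf)
  then have "f \<in> {f \<in> Poly r. \<forall>i\<le>r. v (coeff f i) = s i}"
    by (simp add: Poly_def cf t)
  then show ?thesis by blast
qed

text \<open>
  If the middle coefficients are tiny, the equation \<open>g(\<alpha>) = 0\<close> forces the leading and the
  constant term to have equal absolute value (the Newton polygon is a single segment). So all
  roots of \<open>g\<close> lie on one sphere, whose radius is read off from the coefficients.
\<close>

lemma v_root_two_term_dominance:
  assumes "degree g = r" "0 < \<rho>" "\<rho> < 1" "C > 0"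
    and "v (coeff g r) = C" "v (coeff g 0) = C * \<rho> ^ r"
    and small: "\<And>i. 0 < i \<Longrightarrow> i < r \<Longrightarrow> v (coeff g i) < C * \<rho> ^ r"
    and "r > 0" "poly g \<alpha> = 0"
  shows "v \<alpha> = \<rho>"
proof (rule ccontr)
  assume neq: "v \<alpha> \<noteq> \<rho>"
  define M where "M = max (C * \<rho> ^ r) (C * v \<alpha> ^ r)"
  have M: "M > 0" using assms by (simp add: M_def less_max_iff_disj)
  have ne: "v \<alpha> ^ r \<noteq> \<rho> ^ r"
    using neq power_eq_imp_eq_base[of "v \<alpha>" r \<rho>] \<open>0 < \<rho>\<close> \<open>r > 0\<close> nonneg[of \<alpha>] by auto
  have split: "{..r} = insert 0 (insert r {0<..<r})" using assms by auto
  have eq: "coeff g 0 + coeff g r * \<alpha> ^ r = - (\<Sum>i\<in>{0<..<r}. coeff g i * \<alpha> ^ i)"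
    using assms(9) \<open>r > 0\<close> unfolding poly_altdef assms(1) split
    by (simp add: add.assoc[symmetric] eq_neg_iff_add_eq_0)
  have "v (coeff g 0 + coeff g r * \<alpha> ^ r) = M"
  proof (cases "\<rho> ^ r < v \<alpha> ^ r")
    case True
    then have "v (coeff g 0) < v (coeff g r * \<alpha> ^ r)"
      using assms by (simp add: mult v_power)
    from v_add_eq_left[OF this] show ?thesis
      using True assms by (simp add: M_def mult v_power add.commute)
  next
    case False
    then have less: "v \<alpha> ^ r < \<rho> ^ r" using ne by simp
    then have "v (coeff g r * \<alpha> ^ r) < v (coeff g 0)"
      using assms by (simp add: mult v_power)
    from v_add_eq_left[OF this] show ?thesis
      using less assms by (simp add: M_def)
  qed
  moreover have "v (\<Sum>i\<in>{0<..<r}. coeff g i * \<alpha> ^ i) < M"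
  proof (rule v_sum_less)
    fix i assume i: "i \<in> {0<..<r}"
    then have ci: "v (coeff g i) < C * \<rho> ^ r" using small by simp
    show "v (coeff g i * \<alpha> ^ i) < M"
    proof (cases "v \<alpha> \<le> 1")
      case True
      then have "v (coeff g i) * v \<alpha> ^ i \<le> v (coeff g i)"
        using nonneg by (intro mult_left_le power_le_one) auto
      then show ?thesis using ci by (simp add: mult v_power M_def less_max_iff_disj)
    next
      case False
      have "v (coeff g i) * v \<alpha> ^ i \<le> v (coeff g i) * v \<alpha> ^ r"
        using False i nonneg by (intro mult_left_mono power_increasing) auto
      also have "\<dots> < C * v \<alpha> ^ r"
      proof (rule mult_strict_right_mono)
        have "\<rho> ^ r \<le> 1" using assms by (intro power_le_one) auto
        then have "C * \<rho> ^ r \<le> C" using assms by (simp add: mult_left_le)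
        then show "v (coeff g i) < C" using ci by simp
      qed (use False in simp)
      finally show ?thesis by (simp add: mult v_power M_def less_max_iff_disj)
    qed
  qed (use M in auto)
  ultimately show False unfolding eq by simp
qed

end

text \<open>
  The pairs \<open>(g, \<alpha>)\<close> of a polynomial of degree at most \<open>r\<close> and one of its roots form a
  hypersurface, on which the constant coefficient is a polynomial in the root and the other
  coefficients. \<open>coeffs_and_point\<close> lists all coefficients and the root; \<open>root_coords\<close> gives the
  free coordinates of the hypersurface, and \<open>from_root_coords\<close> recovers the former from the
  latter. The leading coefficient and the root come first, because \<open>generic_radii\<close> makes the
  later coordinates tiny compared with the earlier ones, as \<open>v_root_two_term_dominance\<close> requires
  of the middle coefficients.
\<close>

definition coeffs_and_point :: "nat \<Rightarrow> 'a::comm_ring_1 poly \<Rightarrow> 'a \<Rightarrow> nat \<Rightarrow> 'a" where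
  "coeffs_and_point r g \<alpha> i = (if i \<le> r then coeff g i else \<alpha>)"

definition root_coords :: "nat \<Rightarrow> 'a::comm_ring_1 poly \<Rightarrow> 'a \<Rightarrow> nat \<Rightarrow> 'a" where
  "root_coords r g \<alpha> k = (if k = 0 then coeff g r else if k = 1 then \<alpha> else coeff g (k - 1))"

definition from_root_coords :: "nat \<Rightarrow> (nat \<Rightarrow> 'a::comm_ring_1) \<Rightarrow> nat \<Rightarrow> 'a" where
  "from_root_coords r x i =
    (if i = 0 then - (x 0 * x 1 ^ r + (\<Sum>j\<in>{0<..<r}. x (Suc j) * x 1 ^ j))
     else if i < r then x (Suc i) else if i = r then x 0 else x 1)"

lemma polynomial_fun_from_root_coords:
  "r \<ge> 1 \<Longrightarrow> polynomial_fun (Suc r) (\<lambda>x. from_root_coords r x i)"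
  unfolding from_root_coords_def
  by (cases "i = 0"; cases "i < r"; cases "i = r") (auto intro!: polynomial_fun_intros)

lemma from_root_coords_root_coords:
  assumes "degree g \<le> r" "r \<ge> 1" "poly g \<alpha> = 0"
  shows "from_root_coords r (root_coords r g \<alpha>) = coeffs_and_point r g \<alpha>"
proof -
  have split: "{..r} = insert 0 (insert r {0<..<r})" using assms by auto
  have "poly g \<alpha> = (\<Sum>i\<le>r. coeff g i * \<alpha> ^ i)"
    using assms(1) by (rule poly_eq_sum_upto)
  then have "coeff g 0 = - (coeff g r * \<alpha> ^ r + (\<Sum>j\<in>{0<..<r}. coeff g j * \<alpha> ^ j))"
    using assms unfolding split by (simp add: eq_neg_iff_add_eq_0 del: minus_add_distrib)
  moreover have "(\<Sum>j\<in>{0<..<r}. root_coords r g \<alpha> (Suc j) * root_coords r g \<alpha> 1 ^ j)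
      = (\<Sum>j\<in>{0<..<r}. coeff g j * \<alpha> ^ j)"
    by (intro sum.cong) (auto simp: root_coords_def)
  ultimately show ?thesis
    by (auto simp: fun_eq_iff from_root_coords_def coeffs_and_point_def root_coords_def)
qed

context nonarch_closure
begin

lemma hom_0 [simp]: "\<iota> 0 = 0"
  using hom_add[of 0 0] by (simp only: add_0 add_cancel_right_right)

lemma hom_sum: "\<iota> (\<Sum>i\<in>A. g i) = (\<Sum>i\<in>A. \<iota> (g i))"
  by (induction A rule: infinite_finite_induct) (simp_all add: hom_add)

lemma hom_prod: "\<iota> (\<Prod>i\<in>A. g i) = (\<Prod>i\<in>A. \<iota> (g i))"
  by (induction A rule: infinite_finite_induct) (simp_all add: hom_mult hom_1)

lemma hom_power: "\<iota> (x ^ n) = \<iota> x ^ n"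
  by (induction n) (simp_all add: hom_mult hom_1)

lemma hom_of_nat: "\<iota> (of_nat n) = of_nat n"
  by (induction n) (simp_all add: hom_add hom_1)

lemma hom_eq_0_iff [simp]: "\<iota> x = 0 \<longleftrightarrow> x = 0"
  using extends[of x] L.eq_0_iff K.eq_0_iff by metis

lemma coeff_map_hom [simp]: "coeff (map_poly \<iota> f) i = \<iota> (coeff f i)"
  by (simp add: coeff_map_poly)

lemma degree_map_hom [simp]: "degree (map_poly \<iota> f) = degree f"
  by (rule degree_map_poly) simp

lemma map_poly_hom_add: "map_poly \<iota> (f + g) = map_poly \<iota> f + map_poly \<iota> g"
  by (rule poly_eqI) (simp add: hom_add)

lemma map_poly_hom_mult: "map_poly \<iota> (f * g) = map_poly \<iota> f * map_poly \<iota> g"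
  by (rule poly_eqI) (simp add: coeff_mult hom_sum hom_mult)

lemma coprime_imp_no_common_root:
  assumes "coprime P Q"
  shows "poly (map_poly \<iota> P) z \<noteq> 0 \<or> poly (map_poly \<iota> Q) z \<noteq> 0"
proof -
  obtain a b where "a * P + b * Q = 1" using bezout_poly_field[OF assms] by blast
  from arg_cong[OF this, of "map_poly \<iota>"]
  have "map_poly \<iota> a * map_poly \<iota> P + map_poly \<iota> b * map_poly \<iota> Q = 1"
    by (simp add: map_poly_hom_add map_poly_hom_mult hom_1)
  from arg_cong[OF this, of "\<lambda>p. poly p z"] show ?thesis by auto
qed

text \<open>
  This replaces the monodromy argument that is available over the complex numbers. The radii
  for the free coordinates of the hypersurface determine prescribed absolute values of all
  coefficients, which define a nonempty open set \<open>\<Omega>\<close> of polynomials over the small field. Every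
  root of every member of \<open>\<Omega>\<close> has the same absolute value, so all pairs \<open>(f, \<alpha>)\<close> with
  \<open>f \<in> \<Omega>\<close> lie on the same product of spheres, where each \<open>E\<close> is zero or of constant absolute
  value. No such \<open>E\<close> can tell the roots of \<open>f\<close> apart by its absolute value.
\<close>

lemma open_set_with_indistinguishable_roots:
  assumes "r \<ge> 1" "finite \<E>" and poly: "\<And>E. E \<in> \<E> \<Longrightarrow> polynomial_fun (r + 2) E"
  shows "\<exists>\<Omega>. openin (Poly_topology v r) \<Omega> \<and> \<Omega> \<noteq> {} \<and> (\<forall>E\<in>\<E>.
    (\<forall>g \<alpha>. degree g \<le> r \<longrightarrow> poly g \<alpha> = 0 \<longrightarrow> E (coeffs_and_point r g \<alpha>) = 0) \<or>
    (\<exists>C>0. \<forall>f\<in>\<Omega>. \<forall>\<alpha>. poly (map_poly \<iota> f) \<alpha> = 0 \<longrightarrow>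
       w (E (coeffs_and_point r (map_poly \<iota> f) \<alpha>)) = C))"
proof -
  define b :: "nat \<Rightarrow> (nat \<Rightarrow> real) \<Rightarrow> real"
    where "b i \<rho> = (if i < 2 then 1 else \<rho> 0 * \<rho> 1 ^ r)" for i \<rho>
  define \<F> where "\<F> = (\<lambda>E x. E (from_root_coords r x)) ` \<E>"
  have \<Gamma>: "\<exists>s\<in>range v. 0 < s \<and> s < e" if "e > 0" for e
    using K.ex_small[OF that] K.v_pos_iff by blast
  have "\<exists>\<rho>. (\<forall>i<Suc r. \<rho> i \<in> range v \<and> 0 < \<rho> i \<and> \<rho> i < b i \<rho>) \<and>
      (\<forall>E\<in>\<F>. (\<forall>x. E x = 0) \<or> (\<exists>C>0. \<forall>x\<in>L.sphere_tuples (Suc r) \<rho>. w (E x) = C))"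
  proof (rule L.generic_radii)
    show "\<exists>s\<in>range v. 0 < s \<and> s < e" if "e > 0" for e
      using that by (rule \<Gamma>)
    show "b i \<rho> > 0" if "\<And>j. j < i \<Longrightarrow> \<rho> j > 0" for i \<rho>
      using that[of 0] that[of 1] by (simp add: b_def)
    show "b i \<rho> = b i \<rho>'" if "\<And>j. j < i \<Longrightarrow> \<rho> j = \<rho>' j" for i \<rho> \<rho>'
      using that[of 0] that[of 1] by (simp add: b_def)
    show "finite \<F>" using assms(2) by (simp add: \<F>_def)
    show "polynomial_fun (Suc r) E" if "E \<in> \<F>" for E
    proof -
      from that obtain E' where E': "E' \<in> \<E>" "E = (\<lambda>x. E' (from_root_coords r x))"
        unfolding \<F>_def by (rule imageE)
      show ?thesis
        unfolding E'(2)
        by (rule polynomial_fun_compose[OF poly[OF E'(1)] polynomial_fun_from_root_coords[OF assms(1)]])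
    qed
  qed
  then obtain \<rho> where \<rho>': "\<forall>i<Suc r. \<rho> i \<in> range v \<and> 0 < \<rho> i \<and> \<rho> i < b i \<rho>"
    and dich: "\<forall>E\<in>\<F>. (\<forall>x. E x = 0) \<or> (\<exists>C>0. \<forall>x\<in>L.sphere_tuples (Suc r) \<rho>. w (E x) = C)"
    by (elim exE conjE)
  note \<rho> = mp[OF spec[OF \<rho>']]
  \<comment> \<open>The radius for \<open>coeff f 0\<close> is the one that makes every root have absolute value \<open>\<rho> 1\<close>.\<close>
  define s where "s i = (if i = 0 then \<rho> 0 * \<rho> 1 ^ r else if i = r then \<rho> 0 else \<rho> (Suc i))" for i
  define \<Omega> where "\<Omega> = {f \<in> Poly r. \<forall>i\<le>r. v (coeff f i) = s i}"
  have s_pos: "s i > 0" if "i \<le> r" for i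
    using \<rho> that assms(1) by (simp add: s_def)
  have "s i \<in> range v" if i: "i \<le> r" for i
  proof (cases "i = 0")
    case True
    have "\<rho> 0 \<in> range v" "\<rho> 1 \<in> range v" using \<rho>[of 0] \<rho>[of 1] assms(1) by auto
    then obtain t0 t1 where "\<rho> 0 = v t0" "\<rho> 1 = v t1" by (elim imageE)
    then have "v (t0 * t1 ^ r) = s i"
      using True by (simp add: s_def K.mult K.v_power)
    then show ?thesis by (rule range_eqI[OF sym])
  next
    case False
    then show ?thesis using \<rho>[of 0] \<rho>[of "Suc i"] i by (auto simp: s_def)
  qed
  then have ne: "\<Omega> \<noteq> {}"
    unfolding \<Omega>_def using s_pos by (intro K.ex_poly_on_spheres) auto
  have op: "openin (Poly_topology v r) \<Omega>"
    unfolding \<Omega>_def using s_pos by (rule K.openin_Poly_topology_spheres)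
  have coords: "root_coords r (map_poly \<iota> f) \<alpha> \<in> L.sphere_tuples (Suc r) \<rho>"
    if f: "f \<in> \<Omega>" and \<alpha>: "poly (map_poly \<iota> f) \<alpha> = 0" for f \<alpha>
  proof -
    have deg: "degree f = r" and cf: "\<And>i. i \<le> r \<Longrightarrow> v (coeff f i) = s i"
      using f by (auto simp: \<Omega>_def Poly_def)
    have "w \<alpha> = \<rho> 1"
    proof (rule L.v_root_two_term_dominance[of "map_poly \<iota> f" r _ "\<rho> 0"])
      fix i assume i: "0 < i" "i < r"
      then show "w (coeff (map_poly \<iota> f) i) < \<rho> 0 * \<rho> 1 ^ r"
        using cf[of i] \<rho>[of "Suc i"] by (simp add: extends s_def b_def)
    qed (use deg cf \<rho>[of 0] \<rho>[of 1] assms(1) \<alpha> in \<open>auto simp: extends s_def b_def\<close>)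
    then show ?thesis
      using cf assms(1) by (auto simp: L.sphere_tuples_def root_coords_def extends s_def)
  qed
  have "(\<forall>g \<alpha>. degree g \<le> r \<longrightarrow> poly g \<alpha> = 0 \<longrightarrow> E (coeffs_and_point r g \<alpha>) = 0) \<or>
    (\<exists>C>0. \<forall>f\<in>\<Omega>. \<forall>\<alpha>. poly (map_poly \<iota> f) \<alpha> = 0 \<longrightarrow>
       w (E (coeffs_and_point r (map_poly \<iota> f) \<alpha>)) = C)" if "E \<in> \<E>" for E
  proof -
    have "(\<lambda>x. E (from_root_coords r x)) \<in> \<F>" using that by (simp add: \<F>_def)
    from bspec[OF dich this] show ?thesis
    proof
      assume "\<forall>x. E (from_root_coords r x) = 0"
      then have "E (coeffs_and_point r g \<alpha>) = 0" if "degree g \<le> r" "poly g \<alpha> = 0" for g \<alpha>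
        using from_root_coords_root_coords[OF that(1) assms(1) that(2)] by (metis (full_types))
      then show ?thesis by blast
    next
      assume "\<exists>C>0. \<forall>x\<in>L.sphere_tuples (Suc r) \<rho>. w (E (from_root_coords r x)) = C"
      then obtain C where C: "C > 0"
        "\<And>x. x \<in> L.sphere_tuples (Suc r) \<rho> \<Longrightarrow> w (E (from_root_coords r x)) = C" by blast
      have "w (E (coeffs_and_point r (map_poly \<iota> f) \<alpha>)) = C"
        if f: "f \<in> \<Omega>" and \<alpha>: "poly (map_poly \<iota> f) \<alpha> = 0" for f \<alpha>
      proof -
        have "degree (map_poly \<iota> f) \<le> r" using f by (simp add: \<Omega>_def Poly_def)
        from from_root_coords_root_coords[OF this assms(1) \<alpha>] C(2)[OF coords[OF f \<alpha>]]
        show ?thesis by simp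
      qed
      then show ?thesis using C(1) by blast
    qed
  qed
  then show ?thesis using op ne by blast
qed

end

section \<open>Algorithms are not generally convergent\<close>

lemma degree_pderiv_le_degree:
  fixes p :: "'a::{comm_semiring_1,semiring_no_zero_divisors} poly"
  shows "degree (pderiv p) \<le> degree p"
  by (rule degree_le) (simp add: coeff_pderiv coeff_eq_0)

lemma polynomial_fun_coeff_pderiv:
  assumes "\<And>j. polynomial_fun n (\<lambda>x. coeff (G x) j)"
  shows "polynomial_fun n (\<lambda>x. coeff (pderiv (G x)) j)"
  unfolding coeff_pderiv by (intro polynomial_fun_intros assms)

lemma polynomial_fun_coeff_fixed_point_poly:
  assumes "\<And>j. polynomial_fun n (\<lambda>x. coeff (P x) j)" "\<And>j. polynomial_fun n (\<lambda>x. coeff (Q x) j)"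
  shows "polynomial_fun n (\<lambda>x. coeff (fixed_point_poly (P x) (Q x)) j)"
  unfolding fixed_point_poly_def coeff_diff
  by (rule polynomial_fun_diff; cases j) (auto intro: polynomial_fun.const assms)

lemma degree_fixed_point_poly_le:
  "degree P \<le> d \<Longrightarrow> degree Q \<le> d \<Longrightarrow> degree (fixed_point_poly P Q) \<le> Suc d"
  unfolding fixed_point_poly_def using degree_pCons_le[of 0 Q] by (intro degree_diff_le) auto

text \<open>
  Polynomials whose coefficients vary with a parameter, with a degree bound independent of the
  parameter as \<open>polynomial_fun_poly\<close> needs it.
\<close>

definition truncated_poly :: "nat \<Rightarrow> (nat \<Rightarrow> 'a::comm_ring_1) \<Rightarrow> 'a poly" where
  "truncated_poly n c = (\<Sum>i\<le>n. monom (c i) i)"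

lemma coeff_truncated_poly: "coeff (truncated_poly n c) j = (if j \<le> n then c j else 0)"
  by (simp add: truncated_poly_def coeff_sum)

lemma degree_truncated_poly: "degree (truncated_poly n c) \<le> n"
  by (rule degree_le) (simp add: coeff_truncated_poly)

lemma polynomial_fun_coeff_truncated_poly:
  "(\<And>i. i \<le> n \<Longrightarrow> polynomial_fun m (\<lambda>x. c x i)) \<Longrightarrow>
    polynomial_fun m (\<lambda>x. coeff (truncated_poly n (c x)) j)"
  unfolding coeff_truncated_poly by (cases "j \<le> n") (auto intro: polynomial_fun.const)

context nonarch_closure
begin

definition mpoly_eval_ext :: "(nat \<Rightarrow> 'l) \<Rightarrow> 'k mpoly \<Rightarrow> 'l" where
  "mpoly_eval_ext y A = (\<Sum>m\<in>Poly_Mapping.keys A. \<iota> (Poly_Mapping.lookup A m) *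
     (\<Prod>i\<in>Poly_Mapping.keys m. y i ^ Poly_Mapping.lookup m i))"

lemma polynomial_fun_mpoly_eval_ext:
  assumes "mpoly_vars A \<subseteq> {..r}" "r < n"
  shows "polynomial_fun n (\<lambda>y. mpoly_eval_ext y A)"
  unfolding mpoly_eval_ext_def
proof (intro polynomial_fun_intros)
  fix m i assume "m \<in> Poly_Mapping.keys A" "i \<in> Poly_Mapping.keys m"
  then have "i \<in> mpoly_vars A" unfolding mpoly_vars_def by blast
  then show "i < n" using assms by auto
qed

text \<open>
  The coefficients of \<open>T_f\<close> are polynomial functions of the coefficients of \<open>f\<close>. The value \<open>\<alpha>\<close> is
  arbitrary, since it occupies a variable in which \<open>A\<close> is constant.
\<close>

lemma hom_mpoly_eval:
  assumes "mpoly_vars A \<subseteq> {..r}"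
  shows "\<iota> (mpoly_eval (coeff f) A) = mpoly_eval_ext (coeffs_and_point r (map_poly \<iota> f) \<alpha>) A"
  unfolding mpoly_eval_def mpoly_eval_ext_def hom_sum hom_mult hom_prod hom_power
proof (intro sum.cong prod.cong refl arg_cong2[of _ _ _ _ "(*)"])
  fix m i assume "m \<in> Poly_Mapping.keys A" "i \<in> Poly_Mapping.keys m"
  then have "i \<in> mpoly_vars A" unfolding mpoly_vars_def by blast
  then have "i \<le> r" using assms by auto
  then show "\<iota> (coeff f i) ^ Poly_Mapping.lookup m i =
      coeffs_and_point r (map_poly \<iota> f) \<alpha> i ^ Poly_Mapping.lookup m i"
    by (simp add: coeffs_and_point_def)
qed

lemma map_poly_hom_algorithm:
  assumes "\<And>i. i \<le> d \<Longrightarrow> mpoly_vars (A i) \<subseteq> {..r}"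
  shows "map_poly \<iota> (\<Sum>i\<le>d. monom (mpoly_eval (coeff f) (A i)) i) =
    truncated_poly d (\<lambda>i. mpoly_eval_ext (coeffs_and_point r (map_poly \<iota> f) \<alpha>) (A i))"
  using assms by (intro poly_eqI) (auto simp: coeff_sum coeff_truncated_poly hom_mpoly_eval)

text \<open>
  Take \<open>f\<close> in the domain of convergence whose roots are indistinguishable for \<open>F\<close>, \<open>Q\<close>, \<open>Q - F'\<close>
  and \<open>f'\<close>. The first three decide which roots are attracting fixed points, so either all or
  none are; the last makes the roots simple. The number of attracting fixed points is thus \<open>0\<close> or
  \<open>r\<close>, and by \<open>card_attracting\<close> it is \<open>r\<close>, with \<open>r - 1\<close> divisible by the residue characteristic
  and \<open>r \<le> d + 1\<close>.
\<close>

theorem not_generally_convergent: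
  assumes r: "r \<ge> 2"
    and p: "residue_char v = 0 \<or> residue_char v > d \<or> residue_char v \<ge> r"
    and vars: "\<And>i. i \<le> d \<Longrightarrow> mpoly_vars (fst T i) \<subseteq> {..r}" "\<And>i. i \<le> d \<Longrightarrow> mpoly_vars (snd T i) \<subseteq> {..r}"
  shows "\<not> generally_convergent v w \<iota> r d T"
proof
  assume "generally_convergent v w \<iota> r d T"
  then obtain U where U: "dense_open (Poly_topology v r) U"
    and conv: "\<forall>f\<in>U. algorithm_at d T f \<in> Rat_maps d \<and>
           (\<exists>W. dense_open (proj_topology w) W \<and>
              (\<forall>z\<in>W. \<exists>\<alpha>. poly (map_poly \<iota> f) \<alpha> = 0 \<and>
                 limitin (proj_topology w)
                   (\<lambda>n. (rat_apply (map_prod (map_poly \<iota>) (map_poly \<iota>) (algorithm_at d T f)) ^^ n) z)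
                   (Fin \<alpha>) sequentially))"
    unfolding generally_convergent_def by (elim exE conjE)
  define PP where "PP y = truncated_poly d (\<lambda>i. mpoly_eval_ext y (fst T i))" for y
  define QQ where "QQ y = truncated_poly d (\<lambda>i. mpoly_eval_ext y (snd T i))" for y
  define FF where "FF y = fixed_point_poly (PP y) (QQ y)" for y
  define DD where "DD y = QQ y - pderiv (FF y)" for y
  define ff where "ff y = pderiv (truncated_poly r y)" for y :: "nat \<Rightarrow> 'l"
  define ev where "ev G y = poly (G y) (y (Suc r))" for G :: "(nat \<Rightarrow> 'l) \<Rightarrow> 'l poly" and y
  have cP: "polynomial_fun (r + 2) (\<lambda>y. coeff (PP y) j)"
    and cQ: "polynomial_fun (r + 2) (\<lambda>y. coeff (QQ y) j)" for j
    unfolding PP_def QQ_def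
    by (intro polynomial_fun_coeff_truncated_poly polynomial_fun_mpoly_eval_ext[where r = r] vars; simp)+
  have cF: "polynomial_fun (r + 2) (\<lambda>y. coeff (FF y) j)" for j
    unfolding FF_def by (rule polynomial_fun_coeff_fixed_point_poly[OF cP cQ])
  have cD: "polynomial_fun (r + 2) (\<lambda>y. coeff (DD y) j)" for j
    unfolding DD_def coeff_diff by (rule polynomial_fun_diff[OF cQ polynomial_fun_coeff_pderiv[OF cF]])
  have cf: "polynomial_fun (r + 2) (\<lambda>y. coeff (ff y) j)" for j
    unfolding ff_def
    by (intro polynomial_fun_coeff_pderiv polynomial_fun_coeff_truncated_poly polynomial_fun.var) simp
  have dQ: "degree (QQ y) \<le> Suc d" and dF: "degree (FF y) \<le> Suc d" for y
    using degree_truncated_poly unfolding FF_def PP_def QQ_def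
    by (auto intro: degree_fixed_point_poly_le le_SucI)
  have dD: "degree (DD y) \<le> Suc d" for y
    unfolding DD_def using dQ[of y] dF[of y] degree_pderiv_le_degree[of "FF y"]
    by (intro degree_diff_le) auto
  have df: "degree (ff y) \<le> r" for y
    unfolding ff_def using degree_pderiv_le_degree[of "truncated_poly r y"] degree_truncated_poly[of r y] by linarith
  have last: "polynomial_fun (r + 2) (\<lambda>y. y (Suc r))" by (rule polynomial_fun.var) simp
  have pf: "polynomial_fun (r + 2) E" if "E \<in> {ev FF, ev QQ, ev DD, ev ff}" for E
    using that polynomial_fun_poly[OF cF dF last] polynomial_fun_poly[OF cQ dQ last]
      polynomial_fun_poly[OF cD dD last] polynomial_fun_poly[OF cf df last]
    unfolding ev_def[abs_def] by blast
  have "r \<ge> 1" using r by simp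
  then have "\<exists>\<Omega>. openin (Poly_topology v r) \<Omega> \<and> \<Omega> \<noteq> {} \<and> (\<forall>E\<in>{ev FF, ev QQ, ev DD, ev ff}.
      (\<forall>g \<alpha>. degree g \<le> r \<longrightarrow> poly g \<alpha> = 0 \<longrightarrow> E (coeffs_and_point r g \<alpha>) = 0) \<or>
      (\<exists>C>0. \<forall>f\<in>\<Omega>. \<forall>\<alpha>. poly (map_poly \<iota> f) \<alpha> = 0 \<longrightarrow>
         w (E (coeffs_and_point r (map_poly \<iota> f) \<alpha>)) = C))"
    by (rule open_set_with_indistinguishable_roots) (simp, rule pf)
  then obtain \<Omega> where \<Omega>: "openin (Poly_topology v r) \<Omega>" "\<Omega> \<noteq> {}"
    and dich: "\<forall>E\<in>{ev FF, ev QQ, ev DD, ev ff}.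
      (\<forall>g \<alpha>. degree g \<le> r \<longrightarrow> poly g \<alpha> = 0 \<longrightarrow> E (coeffs_and_point r g \<alpha>) = 0) \<or>
      (\<exists>C>0. \<forall>f\<in>\<Omega>. \<forall>\<alpha>. poly (map_poly \<iota> f) \<alpha> = 0 \<longrightarrow>
         w (E (coeffs_and_point r (map_poly \<iota> f) \<alpha>)) = C)"
    by (elim exE conjE)
  obtain f where f: "f \<in> U" "f \<in> \<Omega>"
    using dense_open_meets[OF U \<Omega>] by blast
  have degf: "degree f = r"
    using openin_subset[OF \<Omega>(1)] f(2) by (auto simp: Poly_def)
  define g where "g = map_poly \<iota> f"
  have degg: "degree g = r" using degf by (simp add: g_def)
  define pt where "pt = coeffs_and_point r g"
  have same: "w (E (pt \<alpha>)) = w (E (pt \<beta>))"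
    if "E \<in> {ev FF, ev QQ, ev DD, ev ff}" "poly g \<alpha> = 0" "poly g \<beta> = 0" for E \<alpha> \<beta>
    using bspec[OF dich that(1)]
  proof (elim disjE exE conjE)
    assume "\<forall>g \<alpha>. degree g \<le> r \<longrightarrow> poly g \<alpha> = 0 \<longrightarrow> E (coeffs_and_point r g \<alpha>) = 0"
    then show ?thesis using that(2,3) degg by (simp add: pt_def)
  next
    fix C assume "\<forall>f\<in>\<Omega>. \<forall>\<alpha>. poly (map_poly \<iota> f) \<alpha> = 0 \<longrightarrow>
         w (E (coeffs_and_point r (map_poly \<iota> f) \<alpha>)) = C"
    then show ?thesis using that(2,3) f(2) by (simp add: pt_def g_def)
  qed
  have simple: "poly (pderiv g) \<alpha> \<noteq> 0" if "poly g \<alpha> = 0" for \<alpha>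
  proof -
    have tr: "truncated_poly r (coeffs_and_point r h \<beta>) = h" if "degree h \<le> r" for h \<beta>
      using that by (intro poly_eqI) (auto simp: coeff_truncated_poly coeffs_and_point_def coeff_eq_0)
    have ev: "ev ff (coeffs_and_point r h \<beta>) = poly (pderiv h) \<beta>" if "degree h \<le> r" for h \<beta>
      using tr[OF that] by (simp add: ev_def ff_def) (simp add: coeffs_and_point_def)
    \<comment> \<open>The polynomial \<open>z\<close> with its root \<open>0\<close> shows that \<open>f'\<close> is not identically zero on the hypersurface.\<close>
    have "\<not> (\<forall>h \<beta>. degree h \<le> r \<longrightarrow> poly h \<beta> = 0 \<longrightarrow> ev ff (coeffs_and_point r h \<beta>) = 0)"
    proof
      assume "\<forall>h \<beta>. degree h \<le> r \<longrightarrow> poly h \<beta> = 0 \<longrightarrow> ev ff (coeffs_and_point r h \<beta>) = 0"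
      from this[rule_format, of "[:0, 1:]" 0] ev[of "[:0, 1:]" 0] r show False
        by (simp add: pderiv_pCons)
    qed
    then obtain C where "C > 0" "\<forall>f\<in>\<Omega>. \<forall>\<alpha>. poly (map_poly \<iota> f) \<alpha> = 0 \<longrightarrow>
         w (ev ff (coeffs_and_point r (map_poly \<iota> f) \<alpha>)) = C"
      using bspec[OF dich, of "ev ff"] by blast
    then have "w (ev ff (coeffs_and_point r g \<alpha>)) > 0"
      using that f(2) by (simp add: g_def)
    then show ?thesis using degg by (simp add: ev L.v_pos_iff)
  qed
  define P where "P = map_poly \<iota> (fst (algorithm_at d T f))"
  define Q where "Q = map_poly \<iota> (snd (algorithm_at d T f))"
  have P: "PP (pt \<alpha>) = P" and Q: "QQ (pt \<alpha>) = Q" for \<alpha>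
    unfolding PP_def QQ_def P_def Q_def pt_def g_def algorithm_at_def fst_conv snd_conv
    using map_poly_hom_algorithm[of d "fst T" r f \<alpha>] map_poly_hom_algorithm[of d "snd T" r f \<alpha>] vars
    by simp_all
  from bspec[OF conv f(1)] obtain W where rat: "algorithm_at d T f \<in> Rat_maps d"
    and W: "dense_open (proj_topology w) W"
    and lim: "\<forall>z\<in>W. \<exists>\<alpha>. poly (map_poly \<iota> f) \<alpha> = 0 \<and>
                 limitin (proj_topology w)
                   (\<lambda>n. (rat_apply (map_prod (map_poly \<iota>) (map_poly \<iota>) (algorithm_at d T f)) ^^ n) z)
                   (Fin \<alpha>) sequentially"
    by (elim conjE exE)
  have PQ: "map_prod (map_poly \<iota>) (map_poly \<iota>) (algorithm_at d T f) = (P, Q)"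
    by (simp add: P_def Q_def map_prod_def split_beta)
  have cop: "coprime (fst (algorithm_at d T f)) (snd (algorithm_at d T f))"
    and deg: "max (degree (fst (algorithm_at d T f))) (degree (snd (algorithm_at d T f))) = d"
    using rat unfolding Rat_maps_def by auto
  interpret R: root_finding_map w g P Q d W
  proof
    show "g \<noteq> 0" using degg r by auto
    show "max (degree P) (degree Q) = d" using deg by (simp add: P_def Q_def)
    show "poly P z \<noteq> 0 \<or> poly Q z \<noteq> 0" for z
      unfolding P_def Q_def by (rule coprime_imp_no_common_root[OF cop])
    show "dense_open (proj_topology w) W" by (rule W)
    show "\<exists>\<alpha>. poly g \<alpha> = 0 \<and>
      limitin (proj_topology w) (\<lambda>n. (rat_apply (P, Q) ^^ n) z0) (Fin \<alpha>) sequentially"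
      if "z0 \<in> W" for z0
      using bspec[OF lim that] unfolding PQ g_def .
  qed
  have pt_last: "pt \<alpha> (Suc r) = \<alpha>" for \<alpha>
    by (simp add: pt_def coeffs_and_point_def)
  have evF: "ev FF (pt \<alpha>) = poly (fixed_point_poly P Q) \<alpha>" and evQ: "ev QQ (pt \<alpha>) = poly Q \<alpha>"
    and evD: "ev DD (pt \<alpha>) = poly Q \<alpha> - poly (pderiv (fixed_point_poly P Q)) \<alpha>" for \<alpha>
    by (simp_all add: ev_def FF_def DD_def P Q pt_last)
  have att: "R.attracting \<alpha> \<longleftrightarrow> w (ev FF (pt \<alpha>)) = 0 \<and> w (ev DD (pt \<alpha>)) < w (ev QQ (pt \<alpha>))" for \<alpha>
    unfolding R.attracting_def evF evQ evD L.eq_0_iff ..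
  have all: "R.attracting \<beta>" if "R.attracting \<alpha>" "poly g \<alpha> = 0" "poly g \<beta> = 0" for \<alpha> \<beta>
    using that(1) same[OF _ that(2,3), of "ev FF"] same[OF _ that(2,3), of "ev DD"]
      same[OF _ that(2,3), of "ev QQ"] unfolding att by simp
  have root: "poly g \<alpha> = 0" if "R.attracting \<alpha>" for \<alpha>
    using R.nonrepelling_imp_attracting_root[of \<alpha>] that unfolding R.attracting_def by simp
  define N where "N = card {\<alpha>. R.attracting \<alpha>}"
  have N: "w (of_nat N - 1) < 1" "N \<le> d + 1"
    using R.card_attracting by (simp_all add: N_def)
  have "N \<noteq> 0" using N(1) by (intro notI) simp
  then have "{\<alpha>. R.attracting \<alpha>} \<noteq> {}" unfolding N_def by (intro notI) simp
  then obtain \<alpha> where \<alpha>: "R.attracting \<alpha>" by blast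
  have "{\<alpha>. R.attracting \<alpha>} = {\<alpha>. poly g \<alpha> = 0}"
    using root all[OF \<alpha> root[OF \<alpha>]] by blast
  then have "N = r"
    using card_roots_eq_degree[of g] simple degg R.f_nonzero by (simp add: N_def)
  have "of_nat N - 1 = \<iota> (of_nat (r - 1))"
    unfolding hom_of_nat using r \<open>N = r\<close> by (simp add: of_nat_diff)
  then have "v (of_nat (r - 1)) < 1" using N(1) extends by metis
  then have "residue_char v dvd r - 1" by (simp add: K.residue_char_dvd_iff)
  moreover have "r - 1 > 0" using r by simp
  ultimately have "residue_char v \<le> r - 1" "residue_char v \<noteq> 0"
    by (simp_all only: dvd_imp_le) (metis dvd_0_left less_irrefl)
  then show False using p r N(2) \<open>N = r\<close> by auto
qed

end

theorem theorem1p16: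
  fixes v :: "'k::field \<Rightarrow> real" and w :: "'l::alg_closed_field \<Rightarrow> real"
    and \<iota> :: "'k \<Rightarrow> 'l" and r d p :: nat
  assumes "nonarch_closure v w \<iota>"
    and "p = residue_char v"
    and "r \<ge> 2"
    and "p = 0 \<or> p > d \<or> p \<ge> r"
  shows "\<not> (\<exists>T :: 'k algorithm.
    purely_iterative_algorithm r d T \<and> generally_convergent v w \<iota> r d T)"
proof
  assume "\<exists>T :: 'k algorithm. purely_iterative_algorithm r d T \<and> generally_convergent v w \<iota> r d T"
  then obtain T :: "'k algorithm"
    where T: "purely_iterative_algorithm r d T" "generally_convergent v w \<iota> r d T" by blast
  interpret nonarch_closure v w \<iota> by (rule assms(1))
  show False
    using not_generally_convergent[of r d T] T assms(2-4)
    unfolding purely_iterative_algorithm_def by blast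
qed

end
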